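(* Let $F$ be a computable field. There is an algorithm which, given an $F$-algebra $B$ with $\dim_F B=4$ (specified by a multiplication table), returns true if and only if $B$ is a quaternion algebra over $F$, and if so returns an isomorphism $B\cong\left(\frac{a,b}{F}\right)$ for suitable $a,b$.
   Context: A field $F$ is computable if its elements are encoded in bits with deterministic algorithms for the field operations (including division by nonzero elements) and for testing equality with $0$. Algebras are associative with $1$; a multiplication table in a basis $e_1=1,e_2,\dots,e_n$ is the system $(c_{ijk})$ in $F$ with $e_ie_j=\sum_kc_{ijk}e_k$. An isomorphism is output as the matrix of the underlying linear map. A quaternion algebra over $F$ is a central simple $F$-algebra of dimension $4$. $\left(\frac{a,b}{F}\right)$ denotes the $F$-algebra with basis $1,i,j,ij$ where: if $\operatorname{char}F\neq2$, $i^2=a$, $j^2=b$, $ji=-ij$ with $a,b\in F^\times$; if $\operatorname{char}F=2$, $i^2+i=a$, $j^2=b$, $ji=(i+1)j$ with $a\in F$, $b\in F^\times$. *)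

theory Defs
  imports "HOL-Analysis.Cartesian_Space" "HOL-Library.Nat_Bijection"
begin

datatype recf =
    Zero
  | Succ
  | Proj nat
  | Comp recf "recf list"
  | PrimRec recf recf
  | Minim recf

text \<open>
  \<open>eval p xs y\<close>: the program \<open>p\<close> halts on the input \<open>xs\<close> with output \<open>y\<close>.
  Recursion and search are on the first argument.
\<close>

inductive eval :: "recf \<Rightarrow> nat list \<Rightarrow> nat \<Rightarrow> bool" where
  Zero: "eval Zero xs 0"
| Succ: "eval Succ (x # xs) (Suc x)"
| Proj: "i < length xs \<Longrightarrow> eval (Proj i) xs (xs ! i)"
| Comp: "list_all2 (\<lambda>g y. eval g xs y) gs ys \<Longrightarrow> eval f ys z \<Longrightarrow> eval (Comp f gs) xs z"
| PrimRec_0: "eval f xs y \<Longrightarrow> eval (PrimRec f g) (0 # xs) y"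
| PrimRec_Suc: "eval (PrimRec f g) (n # xs) y \<Longrightarrow> eval g (n # y # xs) z \<Longrightarrow>
    eval (PrimRec f g) (Suc n # xs) z"
| Minim: "eval f (n # xs) 0 \<Longrightarrow> (\<forall>m<n. \<exists>k. eval f (m # xs) (Suc k)) \<Longrightarrow> eval (Minim f) xs n"
monos list_all2_mono

lemma eval_deterministic: "eval p xs y \<Longrightarrow> eval p xs y' \<Longrightarrow> y = y'"
proof (induction arbitrary: y' rule: eval.induct)
  case (Zero xs)
  then show ?case by (auto elim: eval.cases)
next
  case (Succ x xs)
  then show ?case by (auto elim: eval.cases)
next
  case (Proj i xs)
  then show ?case by (auto elim: eval.cases)
next
  case (Comp xs gs ys f z)
  from Comp.prems obtain ys' where 1: "list_all2 (\<lambda>g y. eval g xs y) gs ys'" "eval f ys' y'"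
    by (auto elim: eval.cases)
  have "ys = ys'"
    using Comp.IH(1) 1(1) by (auto simp: list_all2_conv_all_nth intro!: nth_equalityI)
  with 1 Comp.IH show ?case by simp
next
  case (PrimRec_0 f xs y g)
  from PrimRec_0.prems have "eval f xs y'" by (auto elim: eval.cases)
  with PrimRec_0.IH show ?case by simp
next
  case (PrimRec_Suc f g n xs y z)
  from PrimRec_Suc.prems obtain y1 where "eval (PrimRec f g) (n # xs) y1" "eval g (n # y1 # xs) y'"
    by (auto elim: eval.cases)
  with PrimRec_Suc.IH show ?case by blast
next
  case (Minim f n xs)
  from Minim.prems have 1: "eval f (y' # xs) 0" "\<forall>m<y'. \<exists>k. eval f (m # xs) (Suc k)"
    by (auto elim: eval.cases)
  have "\<not> y' < n" using Minim.IH(2) 1(1) by fastforce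
  moreover have "\<not> n < y'" using Minim.IH(1) 1(2) by fastforce
  ultimately show ?case by simp
qed

text \<open>
  The bit string \<open>w\<close> is handed to a program as the number whose binary expansion
  is \<open>w\<close> (least significant bit first) with a leading 1, which makes the coding injective.
\<close>

definition code :: "bool list \<Rightarrow> nat" where
  "code w = horner_sum of_bool 2 (w @ [True])"

lemma inj_code: "inj code"
proof -
  have simps: "code [] = 1" "code (b # u) = of_bool b + 2 * code u" for b u
    by (simp_all add: code_def)
  have pos: "code u > 0" for u
    by (induction u) (simp_all add: simps)
  have "v = w" if "code v = code w" for v w
    using that
  proof (induction v arbitrary: w)
    case Nil
    then show ?case
    proof (cases w)
      case (Cons b u)
      with Nil pos[of u] show ?thesis by (cases b) (auto simp: simps)
    qed simp
  next
    case (Cons a v)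
    then show ?case
    proof (cases w)
      case Nil
      with Cons.prems pos[of v] show ?thesis by (cases a) (auto simp: simps)
    next
      case (Cons b u)
      with Cons.prems have "of_bool a + 2 * code v = of_bool b + 2 * code u"
        by (simp add: simps)
      then have "a = b \<and> code v = code u"
        by (cases a; cases b; simp; presburger)
      with Cons.IH Cons show ?thesis by simp
    qed
  qed
  then show ?thesis by (auto intro: injI)
qed

text \<open>
  \<open>dec w = Some x\<close> means that \<open>w\<close> encodes \<open>x\<close>. An element may have several
  encodings, and strings that encode nothing are allowed.
\<close>

definition computes_binop ::
  "(bool list \<Rightarrow> 'a option) \<Rightarrow> recf \<Rightarrow> ('a \<Rightarrow> 'a \<Rightarrow> bool) \<Rightarrow> ('a \<Rightarrow> 'a \<Rightarrow> 'a) \<Rightarrow> bool" where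
  "computes_binop dec p D f \<longleftrightarrow>
    (\<forall>u v x y. dec u = Some x \<and> dec v = Some y \<and> D x y \<longrightarrow>
      (\<exists>w. eval p [code u, code v] (code w) \<and> dec w = Some (f x y)))"

definition computable_field :: "(bool list \<Rightarrow> 'a::field option) \<Rightarrow> bool" where
  "computable_field dec \<longleftrightarrow>
    (\<forall>x. \<exists>w. dec w = Some x) \<and>
    (\<exists>p. computes_binop dec p (\<lambda>x y. True) (+)) \<and>
    (\<exists>p. computes_binop dec p (\<lambda>x y. True) (-)) \<and>
    (\<exists>p. computes_binop dec p (\<lambda>x y. True) (*)) \<and>
    (\<exists>p. computes_binop dec p (\<lambda>x y. y \<noteq> 0) (/)) \<and>
    (\<exists>p. \<forall>w x. dec w = Some x \<longrightarrow> eval p [code w] (if x = 0 then 1 else 0))"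

definition encodes :: "(bool list \<Rightarrow> 'a option) \<Rightarrow> bool list list \<Rightarrow> 'a list \<Rightarrow> bool" where
  "encodes dec ws xs \<longleftrightarrow> map dec ws = map Some xs"

locale assoc_algebra = vector_space scl
  for scl :: "'a::field \<Rightarrow> 'b::ab_group_add \<Rightarrow> 'b" +
  fixes mul :: "'b \<Rightarrow> 'b \<Rightarrow> 'b" and one :: 'b
  assumes mul_assoc: "mul (mul x y) z = mul x (mul y z)"
    and one_mul: "mul one x = x"
    and mul_one: "mul x one = x"
    and add_mul: "mul (x + y) z = mul x z + mul y z"
    and mul_add: "mul x (y + z) = mul x y + mul x z"
    and scl_mul: "mul (scl r x) y = scl r (mul x y)"
    and mul_scl: "mul x (scl r y) = scl r (mul x y)"

definition center :: "('b \<Rightarrow> 'b \<Rightarrow> 'b) \<Rightarrow> 'b set" where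
  "center mul = {z. \<forall>x. mul z x = mul x z}"

definition two_sided_ideal :: "('b::ab_group_add \<Rightarrow> 'b \<Rightarrow> 'b) \<Rightarrow> 'b set \<Rightarrow> bool" where
  "two_sided_ideal mul I \<longleftrightarrow>
    0 \<in> I \<and> (\<forall>x\<in>I. \<forall>y\<in>I. x - y \<in> I) \<and> (\<forall>x\<in>I. \<forall>b. mul b x \<in> I \<and> mul x b \<in> I)"

definition central_simple ::
  "('a::field \<Rightarrow> 'b::ab_group_add \<Rightarrow> 'b) \<Rightarrow> ('b \<Rightarrow> 'b \<Rightarrow> 'b) \<Rightarrow> 'b \<Rightarrow> bool" where
  "central_simple scl mul one \<longleftrightarrow>
    assoc_algebra scl mul one \<and>
    center mul = range (\<lambda>r. scl r one) \<and>
    (UNIV :: 'b set) \<noteq> {0} \<and>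
    (\<forall>I. two_sided_ideal mul I \<longrightarrow> I = {0} \<or> I = UNIV)"

definition quaternion_algebra ::
  "('a::field \<Rightarrow> 'b::ab_group_add \<Rightarrow> 'b) \<Rightarrow> ('b \<Rightarrow> 'b \<Rightarrow> 'b) \<Rightarrow> 'b \<Rightarrow> bool" where
  "quaternion_algebra scl mul one \<longleftrightarrow>
    central_simple scl mul one \<and> vector_space.dim scl (UNIV :: 'b set) = 4"

definition algebra_iso ::
  "('a::field \<Rightarrow> 'b::ab_group_add \<Rightarrow> 'b) \<Rightarrow> ('b \<Rightarrow> 'b \<Rightarrow> 'b) \<Rightarrow> 'b \<Rightarrow>
   ('a \<Rightarrow> 'c::ab_group_add \<Rightarrow> 'c) \<Rightarrow> ('c \<Rightarrow> 'c \<Rightarrow> 'c) \<Rightarrow> 'c \<Rightarrow> ('b \<Rightarrow> 'c) \<Rightarrow> bool" where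
  "algebra_iso scale1 mul1 one1 scale2 mul2 one2 f \<longleftrightarrow>
    Vector_Spaces.linear scale1 scale2 f \<and> bij f \<and>
    f one1 = one2 \<and> (\<forall>x y. f (mul1 x y) = mul2 (f x) (f y))"

text \<open>
  A table \<open>c\<close> specifies the algebra on \<open>F\<^sup>4\<close> whose standard basis vectors
  \<open>e i = axis i 1\<close> multiply as \<open>e i * e j = (\<Sum>k. c $ i $ j $ k *s e k)\<close>. The four elements
  of the index type are \<open>1, 2, 3, 4\<close> (where \<open>4 = 0\<close>), and \<open>e 1\<close> is the identity.
\<close>

definition table_mult :: "'a::field^4^4^4 \<Rightarrow> 'a^4 \<Rightarrow> 'a^4 \<Rightarrow> 'a^4" where
  "table_mult c x y = (\<chi> k. \<Sum>i\<in>UNIV. \<Sum>j\<in>UNIV. x $ i * y $ j * c $ i $ j $ k)"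

definition multiplication_table :: "'a::field^4^4^4 \<Rightarrow> bool" where
  "multiplication_table c \<longleftrightarrow> assoc_algebra (*s) (table_mult c) (axis 1 1)"

definition table_entries :: "'a^4^4^4 \<Rightarrow> 'a list" where
  "table_entries c = [c $ i $ j $ k. i \<leftarrow> [1,2,3,4], j \<leftarrow> [1,2,3,4], k \<leftarrow> [1,2,3,4]]"

definition matrix_entries :: "'a^4^4 \<Rightarrow> 'a list" where
  "matrix_entries M = [M $ i $ j. i \<leftarrow> [1,2,3,4], j \<leftarrow> [1,2,3,4]]"

lemma table_mult_axis:
  "table_mult c (axis i 1) (axis j 1) = (\<Sum>k\<in>UNIV. c $ i $ j $ k *s axis k 1)"
proof -
  have "(\<Sum>i'\<in>UNIV. \<Sum>j'\<in>UNIV. axis i 1 $ i' * axis j 1 $ j' * c $ i' $ j' $ k) = c $ i $ j $ k" for k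
  proof -
    have "(\<Sum>i'\<in>UNIV. \<Sum>j'\<in>UNIV. axis i 1 $ i' * axis j 1 $ j' * c $ i' $ j' $ k) =
        (\<Sum>i'\<in>UNIV. if i' = i then \<Sum>j'\<in>UNIV. if j' = j then c $ i $ j $ k else 0 else 0)"
      by (intro sum.cong refl)
        (simp add: axis_def if_distrib[of "\<lambda>x. x * _"] cong: if_cong)
    then show ?thesis by simp
  qed
  then show ?thesis
    by (simp add: table_mult_def vec_eq_iff axis_def if_distrib[of "\<lambda>x. _ * x"] cong: if_cong)
qed

definition quat_params :: "'a::field \<Rightarrow> 'a \<Rightarrow> bool" where
  "quat_params a b \<longleftrightarrow> (CHAR('a) \<noteq> 2 \<longrightarrow> a \<noteq> 0) \<and> b \<noteq> 0"

text \<open>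
  The table in the basis \<open>1, i, j, ij\<close>: row \<open>x\<close>, column \<open>y\<close> holds the coordinates of \<open>x y\<close>.
  It is forced by associativity and the defining relations; see \<open>quat_table_relations\<close>
  and \<open>quat_table_algebra\<close>.
\<close>

definition quat_table :: "'a::field \<Rightarrow> 'a \<Rightarrow> 'a^4^4^4" where
  "quat_table a b =
    (if CHAR('a) = 2 then
       vector [
         vector [vector [1,0,0,0], vector [0,1,0,0], vector [0,0,1,0], vector [0,0,0,1]],
         vector [vector [0,1,0,0], vector [a,1,0,0], vector [0,0,0,1], vector [0,0,a,1]],
         vector [vector [0,0,1,0], vector [0,0,1,1], vector [b,0,0,0], vector [b,b,0,0]],
         vector [vector [0,0,0,1], vector [0,0,a,0], vector [0,b,0,0], vector [a*b,0,0,0]]]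
     else
       vector [
         vector [vector [1,0,0,0], vector [0,1,0,0], vector [0,0,1,0], vector [0,0,0,1]],
         vector [vector [0,1,0,0], vector [a,0,0,0], vector [0,0,0,1], vector [0,0,a,0]],
         vector [vector [0,0,1,0], vector [0,0,0,-1], vector [b,0,0,0], vector [0,-b,0,0]],
         vector [vector [0,0,0,1], vector [0,0,-a,0], vector [0,b,0,0], vector [-(a*b),0,0,0]]])"

lemma vector_4 [simp]:
  "(vector [w,x,y,z] :: ('a::zero)^4) $ 1 = w"
  "(vector [w,x,y,z] :: ('a::zero)^4) $ 2 = x"
  "(vector [w,x,y,z] :: ('a::zero)^4) $ 3 = y"
  "(vector [w,x,y,z] :: ('a::zero)^4) $ 4 = z"
  by (simp_all add: vector_def)

lemma char_2_add_self: "CHAR('a) = 2 \<Longrightarrow> x + x = (0::'a::field)"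
proof -
  assume "CHAR('a) = 2"
  then have "(2::'a) = 0" by (metis of_nat_CHAR of_nat_numeral)
  then show ?thesis by (metis mult_2 mult_zero_left)
qed

lemma quat_table_algebra: "multiplication_table (quat_table a b)"
proof -
  let ?c = "quat_table a b"
  have assoc: "table_mult ?c (table_mult ?c x y) z = table_mult ?c x (table_mult ?c y z)" for x y z
  proof (cases "CHAR('a) = 2")
    case True
    have [simp]: "t + t = 0" "t + (t + s) = s" for t s :: 'a
      using char_2_add_self[OF True, of t] by (simp_all flip: add.assoc)
    show ?thesis
      using True
      by (simp add: vec_eq_iff forall_4 table_mult_def sum_4 quat_table_def algebra_simps)
  next
    case False
    then show ?thesis
      by (simp add: vec_eq_iff forall_4 table_mult_def sum_4 quat_table_def algebra_simps)
  qed
  have unit: "table_mult ?c (axis 1 1) x = x" "table_mult ?c x (axis 1 1) = x" for x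
    by (simp_all add: vec_eq_iff forall_4 table_mult_def sum_4 quat_table_def axis_def)
  show ?thesis
    unfolding multiplication_table_def
    by unfold_locales
      (simp_all add: assoc unit, simp_all add: vec_eq_iff table_mult_def sum.distrib
        sum_distrib_left algebra_simps)
qed

lemma quat_table_relations:
  fixes a b :: "'a::field"
  defines "mul \<equiv> table_mult (quat_table a b)"
  defines "one \<equiv> axis 1 1" and "i \<equiv> axis 2 1" and "j \<equiv> axis 3 1" and "ij \<equiv> axis 4 1"
  shows "mul i j = ij" "mul j j = b *s one"
    and "CHAR('a) \<noteq> 2 \<Longrightarrow> mul i i = a *s one" "CHAR('a) \<noteq> 2 \<Longrightarrow> mul j i = - mul i j"
    and "CHAR('a) = 2 \<Longrightarrow> mul i i + i = a *s one" "CHAR('a) = 2 \<Longrightarrow> mul j i = mul (i + one) j"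
  using char_2_add_self[where ?'a = 'a]
  by (auto simp: assms vec_eq_iff forall_4 table_mult_def sum_4 quat_table_def axis_def)

end

(*
  In a central simple algebra of dimension four every element is quadratic: if x has degree 4 it is
  central, and if it has degree 3 then A = F[x] has codimension 1, so that (x - k) B and B (x - l)
  lie in A for some scalars k, l, and (x - l)(x - k) generates an ideal inside A.
  Take i non-scalar with nonzero discriminant. Every commutator j = [i, y] satisfies
  j i = (tr i - i) j and has scalar square. If all these squares vanished, some nonzero u = [i, e]
  would satisfy u B u = 0, which is impossible. The same argument finds i in characteristic other
  than 2; in characteristic 2, if all squares e_k^2 were scalar, then all commutators would be scalar
  and B would be commutative. In all cases i and y can be taken from the finitely many vectors e_k and e_k + e_l, so
  no unbounded search is needed: the program tests these candidates and accepts exactly when one of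
  them satisfies the quaternion relations, which suffices since (a,b/F) is simple.
*)

theory Submission
  imports Defs "HOL-Analysis.Determinants"
begin

section \<open>Four-dimensional central simple algebras\<close>

text \<open>The discriminant matters because left multiplication by \<open>2i - t\<close> has square
  \<open>t^2 - 4n\<close>. When this is nonzero the multiplication is invertible, and on commutators
  it agrees with the map \<open>[i, _]\<close>. Hence \<open>B\<close> is the sum of the centralizer
  of \<open>i\<close> and the space of commutators, in every characteristic. The sums
  \<open>e_k + e_l\<close> come from polarization: vanishing squares at single vectors and at
  pairwise sums force the products \<open>x y + y x\<close> to vanish, and this is what produces
  \<open>u B u = 0\<close>. On the computational side, the obstacle is that a conditional evaluates
  both of its branches, so a test cannot guard a division. Every function in use is therefore total,
  with \<open>x / 0 = 0\<close>; meaningless candidates are rejected by the relations. The program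
  may depend on \<open>F\<close>, so its characteristic and any constants are built in.\<close>

context assoc_algebra
begin

notation mul (infixl "\<cdot>" 70)

lemma mul_0_left [simp]: "0 \<cdot> x = 0"
  using add_mul[of 0 0 x] by simp

lemma mul_0_right [simp]: "x \<cdot> 0 = 0"
  using mul_add[of x 0 0] by simp

lemma minus_mul: "(- x) \<cdot> y = - (x \<cdot> y)"
  using add_mul[of x "- x" y] by (simp add: eq_neg_iff_add_eq_0 add.commute)

lemma mul_minus: "x \<cdot> (- y) = - (x \<cdot> y)"
  using mul_add[of x y "- y"] by (simp add: eq_neg_iff_add_eq_0 add.commute)

lemma diff_mul: "(x - y) \<cdot> z = x \<cdot> z - y \<cdot> z"
  using add_mul[of x "- y" z] by (simp add: minus_mul)

lemma mul_diff: "x \<cdot> (y - z) = x \<cdot> y - x \<cdot> z"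
  using mul_add[of x y "- z"] by (simp add: mul_minus)

lemmas mul_simps = add_mul mul_add diff_mul mul_diff minus_mul mul_minus scl_mul mul_scl
  one_mul mul_one

lemmas lin_simps = scale_right_distrib scale_left_distrib scale_right_diff_distrib
  scale_left_diff_distrib scale_minus_left scale_minus_right

text \<open>Both sides reduce to \<open>i y i - t y i + n y\<close> once \<open>i i\<close> is
  replaced.\<close>

lemma commutator_mul:
  assumes "i \<cdot> i = scl t i - scl n one"
  shows "(i \<cdot> y - y \<cdot> i) \<cdot> i = scl t (i \<cdot> y - y \<cdot> i) - i \<cdot> (i \<cdot> y - y \<cdot> i)"
proof -
  have "i \<cdot> (i \<cdot> x) = scl t (i \<cdot> x) - scl n x" for x
    by (simp add: assms mul_simps flip: mul_assoc)
  then show ?thesis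
    by (simp add: mul_simps mul_assoc assms lin_simps)
qed

lemma span_mul_closed:
  assumes "\<And>x y. x \<in> S \<Longrightarrow> y \<in> S \<Longrightarrow> x \<cdot> y \<in> span S" "x \<in> span S" "y \<in> span S"
  shows "x \<cdot> y \<in> span S"
  using assms(2)
proof (induction rule: span_induct_alt)
  case (step r s x)
  have "s \<cdot> y \<in> span S"
    using assms(3)
    by (induction rule: span_induct_alt)
      (auto simp: mul_simps span_zero intro!: span_add span_scale assms(1) step)
  with step show ?case
    by (auto simp: mul_simps intro!: span_add span_scale)
qed (simp add: span_zero)

end

locale quaternion_alg = assoc_algebra scl mul one
  for scl :: "'a::field \<Rightarrow> 'b::ab_group_add \<Rightarrow> 'b" and mul (infixl "\<cdot>" 70) and one +
  assumes center_eq: "center mul = range (\<lambda>r. scl r one)"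
    and simple: "two_sided_ideal mul I \<Longrightarrow> I = {0} \<or> I = UNIV"
    and dim_four: "dim (UNIV :: 'b set) = 4"
begin

text \<open>\<open>dim\<close> has the default value 0 when no basis exists. The value 4 rules out
  the default, so the set picked by \<open>SOME\<close> is a basis with 4 elements.\<close>

lemma basis_4:
  obtains B where "independent B" "span B = UNIV" "card B = 4"
proof -
  let ?P = "\<lambda>b :: 'b set. independent b \<and> span b = span UNIV"
  have "\<exists>b. ?P b"
    using dim_four unfolding dim_def by (metis (no_types, lifting) zero_neq_numeral)
  then have "?P (SOME b. ?P b) \<and> card (SOME b. ?P b) = 4"
    using dim_four unfolding dim_def by (metis (mono_tags, lifting) someI_ex)
  then show thesis using that by (simp only: span_UNIV) blast
qed

lemma one_nonzero: "one \<noteq> 0"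
proof
  assume "one = 0"
  then have zero: "x = 0" for x :: 'b
    using one_mul[of x] by simp
  obtain B where "independent B" "card B = 4"
    by (rule basis_4)
  moreover have "B \<subseteq> {0}"
  proof
    fix x assume "x \<in> B"
    show "x \<in> {0}" using zero[of x] by simp
  qed
  ultimately show False using card_mono[of "{0}" B] by simp
qed

text \<open>The elements \<open>x\<close> with \<open>u B x = 0\<close> form a two-sided ideal. If
  it is everything it contains \<open>one\<close>, which gives \<open>u = 0\<close>; otherwise it is
  zero and contains \<open>v\<close>.\<close>

lemma prime:
  assumes "\<And>b. u \<cdot> b \<cdot> v = 0"
  shows "u = 0 \<or> v = 0"
proof -
  let ?I = "{x. \<forall>b. u \<cdot> b \<cdot> x = 0}"
  have "two_sided_ideal mul ?I"
    unfolding two_sided_ideal_def by (simp add: mul_simps) (metis mul_assoc mul_0_left)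
  then have "?I = {0} \<or> ?I = UNIV" by (rule simple)
  then show ?thesis
  proof
    assume "?I = UNIV"
    then have "one \<in> ?I" by blast
    then have "u \<cdot> one \<cdot> one = 0" by blast
    then show ?thesis by (simp add: mul_one)
  qed (use assms in auto)
qed

lemma central_imp_scalar: "(\<And>y. x \<cdot> y = y \<cdot> x) \<Longrightarrow> \<exists>r. x = scl r one"
  using center_eq unfolding center_def by blast

lemma spans_UNIV:
  assumes "independent S" "card S = 4"
  shows "span S = UNIV"
proof -
  obtain B where B: "independent B" "span B = UNIV" "card B = 4"
    by (rule basis_4)
  interpret finite_dimensional_vector_space scl B
    using B by unfold_locales (auto intro: card_ge_0_finite)
  show ?thesis
    using card_eq_dim[of S UNIV] assms dim_four card.infinite[of S] by (auto simp del: dim_UNIV)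
qed

lemma spans_UNIV_card:
  assumes "span S = UNIV" "finite S"
  shows "card S \<ge> 4"
proof -
  obtain B where B: "independent B" "span B = UNIV" "card B = 4"
    by (rule basis_4)
  interpret finite_dimensional_vector_space scl B
    using B by unfold_locales (auto intro: card_ge_0_finite)
  show ?thesis
    using dim_le_card[of UNIV S] assms dim_four by (simp del: dim_UNIV)
qed

lemma quadratic: "\<exists>t n. x \<cdot> x = scl t x + scl n one"
proof (rule ccontr)
  assume nq: "\<nexists>t n. x \<cdot> x = scl t x + scl n one"
  define S where "S = {x \<cdot> x, x, one}"
  have finite: "finite S" by (simp add: S_def)
  have n2: "x \<cdot> x \<notin> span {one, x}"
  proof
    assume "x \<cdot> x \<in> span {one, x}"
    then obtain n where "x \<cdot> x - scl n one \<in> span {x}"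
      using span_breakdown_eq by blast
    then obtain t where "x \<cdot> x - scl n one = scl t x"
      by (auto simp: span_singleton)
    then have "x \<cdot> x = scl t x + scl n one" by (simp add: diff_eq_eq)
    with nq show False by blast
  qed
  have n1: "x \<notin> span {one}"
  proof
    assume "x \<in> span {one}"
    then obtain r where "x = scl r one" by (auto simp: span_singleton)
    then have "x \<cdot> x = scl r x + scl 0 one" by (simp add: mul_simps)
    with nq show False by blast
  qed
  have distinct: "x \<noteq> one" "x \<cdot> x \<noteq> one" "x \<cdot> x \<noteq> x"
    using n1 n2 by (auto simp: span_base)
  have "independent {x, one}"
    using n1 one_nonzero by (simp add: independent_insert)
  then have indep: "independent S" "card S = 3"
    using n2 distinct unfolding S_def
    by (simp_all add: independent_insert[of "x \<cdot> x"] insert_commute[of x])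
  show False
  proof (cases "x \<cdot> (x \<cdot> x) \<in> span S")
    case False
    then have "independent (insert (x \<cdot> (x \<cdot> x)) S)" "card (insert (x \<cdot> (x \<cdot> x)) S) = 4"
      using indep by (auto simp: independent_insert S_def span_base card_insert_if)
    then have U: "span (insert (x \<cdot> (x \<cdot> x)) S) = UNIV" by (rule spans_UNIV)
    \<comment> \<open>\<open>x\<close> commutes with its own powers, which span \<open>B\<close>
      here. Being central it would be scalar, against \<open>n1\<close>.\<close>
    have "x \<cdot> y = y \<cdot> x" for y
    proof -
      have "y \<in> span (insert (x \<cdot> (x \<cdot> x)) S)" using U by simp
      then show ?thesis
        by (induction rule: span_induct_alt) (auto simp: S_def mul_simps mul_assoc)
    qed
    with central_imp_scalar n1 show False by (metis span_base span_scale insertI1)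
  next
    case True
    have S: "one \<in> span S" "x \<in> span S" "x \<cdot> x \<in> span S"
      by (auto simp: S_def intro: span_base)
    have xS: "x \<cdot> y \<in> span S" if "y \<in> span S" for y
      using that by (induction rule: span_induct_alt)
        (use True S in \<open>auto simp: S_def mul_simps span_zero intro!: span_add span_scale\<close>)
    have gen: "y \<cdot> z \<in> span S" if "y \<in> S" "z \<in> span S" for y z
      using that(1) xS[OF that(2)] xS[OF xS[OF that(2)]] that(2)
      by (auto simp: S_def mul_assoc one_mul)
    have closed: "y \<cdot> z \<in> span S" if "y \<in> span S" "z \<in> span S" for y z
      by (rule span_mul_closed[OF gen]) (auto intro: that span_base)
    have "span S \<noteq> UNIV"
      using spans_UNIV_card[of S] indep finite by auto
    then obtain y where y: "y \<notin> span S" by blast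
    have "independent (insert y S)" "card (insert y S) = 4"
      using indep y by (auto simp: independent_insert S_def span_base card_insert_if)
    then have U: "span (insert y S) = UNIV" by (rule spans_UNIV)
    have ex: "\<exists>k. b - scl k y \<in> span S" for b
      using U by (metis span_breakdown_eq UNIV_I)
    \<comment> \<open>\<open>span S\<close> is a subalgebra containing \<open>x\<close>, so
      multiplication by \<open>x\<close> acts on the one-dimensional quotient
      \<open>B / span S\<close>. The scalars \<open>k\<close> and \<open>l\<close> are its
      eigenvalues on the left and on the right; subtracting them sends all of \<open>B\<close> into
      \<open>span S\<close>.\<close>
    obtain k where k: "x \<cdot> y - scl k y \<in> span S" using ex by blast
    obtain l where l: "y \<cdot> x - scl l y \<in> span S" using ex by blast
    have left: "(x - scl k one) \<cdot> b \<in> span S" for b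
    proof -
      obtain r where r: "b - scl r y \<in> span S" using ex by blast
      have "(x - scl k one) \<cdot> (b - scl r y) + scl r (x \<cdot> y - scl k y) \<in> span S"
        by (rule span_add[OF closed[OF span_diff[OF S(2) span_scale[OF S(1)]] r] span_scale[OF k]])
      then show ?thesis by (simp add: mul_simps lin_simps)
    qed
    have right: "b \<cdot> (x - scl l one) \<in> span S" for b
    proof -
      obtain r where r: "b - scl r y \<in> span S" using ex by blast
      have "(b - scl r y) \<cdot> (x - scl l one) + scl r (y \<cdot> x - scl l y) \<in> span S"
        by (rule span_add[OF closed[OF r span_diff[OF S(2) span_scale[OF S(1)]]] span_scale[OF l]])
      then show ?thesis by (simp add: mul_simps lin_simps algebra_simps)
    qed
    \<comment> \<open>\<open>b z d\<close> is the product of \<open>b (x - l)\<close> and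
      \<open>(x - k) d\<close>, both in \<open>span S\<close>. If \<open>z\<close> were zero,
      \<open>x\<close> would be quadratic.\<close>
    define z where "z = (x - scl l one) \<cdot> (x - scl k one)"
    have z: "b \<cdot> z \<cdot> d \<in> span S" for b d
      using closed[OF right[of b] left[of d]] by (simp add: z_def mul_assoc)
    have "z \<noteq> 0"
    proof
      assume "z = 0"
      then have "x \<cdot> x = scl (l + k) x + scl (- (l * k)) one"
        by (simp add: z_def mul_simps lin_simps algebra_simps)
      with nq show False by blast
    qed
    \<comment> \<open>The largest ideal inside \<open>span S\<close>. It contains \<open>z\<close>,
      so simplicity makes it all of \<open>B\<close> and puts \<open>y\<close> into
      \<open>span S\<close>.\<close>
    let ?I = "{w. \<forall>b d. b \<cdot> w \<cdot> d \<in> span S}"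
    have "two_sided_ideal mul ?I"
      unfolding two_sided_ideal_def
      by (auto simp: mul_simps span_zero span_diff) (metis mul_assoc)+
    then have "?I = {0} \<or> ?I = UNIV" by (rule simple)
    with z \<open>z \<noteq> 0\<close> have "?I = UNIV" by blast
    then have "y \<cdot> one \<cdot> one \<in> span S" by blast
    with y show False by (simp add: mul_simps)
  qed
qed

lemma noncommutative: "\<exists>x y. x \<cdot> y \<noteq> y \<cdot> x"
proof (rule ccontr)
  assume "\<not> ?thesis"
  then have "x \<in> span {one}" for x
    using central_imp_scalar[of x] by (auto simp: span_singleton)
  then have "span {one} = UNIV" by blast
  then show False using spans_UNIV_card[of "{one}"] by simp
qed

text \<open>All commutators with \<open>i\<close> have scalar square. If those squares vanish at the
  listed candidates, polarization makes a fixed nonzero commutator \<open>u\<close> anticommute with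
  all commutators, and then \<open>u B u = 0\<close> contradicts \<open>prime\<close>.\<close>

lemma ex_commutator_square_nonzero:
  assumes i: "i \<cdot> i = scl t i - scl n one" and disc: "t * t - 4 * n \<noteq> 0"
    and nonscalar: "\<And>r. i \<noteq> scl r one" and E: "span E = UNIV"
  shows "\<exists>x\<in>E. \<exists>y\<in>insert 0 E. \<exists>b. b \<noteq> 0 \<and>
    (i \<cdot> (x + y) - (x + y) \<cdot> i) \<cdot> (i \<cdot> (x + y) - (x + y) \<cdot> i) = scl b one"
proof (rule ccontr)
  assume neg: "\<not> ?thesis"
  define D where "D y = i \<cdot> y - y \<cdot> i" for y
  \<comment> \<open>Left multiplication by \<open>2i - t\<close>, whose square is multiplication by
    the discriminant \<open>d\<close>.\<close>
  define \<delta> where "\<delta> y = i \<cdot> y + i \<cdot> y - scl t y" for y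
  define d where "d = t * t - (n + n + n + n)"
  have d: "d \<noteq> 0" using disc by (simp add: d_def)
  have ii: "i \<cdot> (i \<cdot> x) = scl t (i \<cdot> x) - scl n x" for x
    by (simp add: i mul_simps flip: mul_assoc)
  have D_add: "D (x + y) = D x + D y" and D_diff: "D (x - y) = D x - D y"
    and D_scl: "D (scl r x) = scl r (D x)" and D_one: "D one = 0" for x y r
    by (simp_all add: D_def mul_simps lin_simps)
  have conj: "D y \<cdot> i = scl t (D y) - i \<cdot> D y" for y
    unfolding D_def by (rule commutator_mul[OF i])
  have DD: "D (D y) = \<delta> (D y)" for y
    using conj[of y] by (simp add: D_def[of "D y"] \<delta>_def)
  have D\<delta>: "D (\<delta> y) = \<delta> (D y)" for y
    by (simp add: D_def \<delta>_def mul_simps mul_assoc lin_simps)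
  have \<delta>_scl: "\<delta> (scl r y) = scl r (\<delta> y)" for r y
    by (simp add: \<delta>_def mul_simps lin_simps mult.commute)
  have \<delta>\<delta>: "\<delta> (\<delta> y) = scl d y" for y
  proof -
    have "scl (n * 4) y = scl n y + (scl n y + (scl n y + scl n y))"
      by (simp flip: scale_left_distrib)
    then show ?thesis
      by (simp add: \<delta>_def mul_simps lin_simps ii d_def algebra_simps)
  qed
  have \<delta>_inj: "y = 0" if "\<delta> y = 0" for y
    using \<delta>\<delta>[of y] d by (simp add: that) (simp add: \<delta>_def)
  have sq: "\<exists>b. D y \<cdot> D y = scl b one" for y
  proof -
    obtain \<tau> m where j: "D y \<cdot> D y = scl \<tau> (D y) + scl m one"
      using quadratic by blast
    \<comment> \<open>Moving \<open>i\<close> past \<open>D y\<close> turns it into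
      \<open>t - i\<close>, and moving it past the second factor turns it back. So the square
      commutes with \<open>i\<close>, and applying \<open>D\<close> to its quadratic equation
      isolates the linear coefficient.\<close>
    have "D y \<cdot> D y \<cdot> i = i \<cdot> (D y \<cdot> D y)"
      by (simp add: mul_assoc conj mul_simps) (simp add: conj mul_simps flip: mul_assoc)
    then have "D (D y \<cdot> D y) = 0" by (simp add: D_def[of "D y \<cdot> D y"])
    then have "\<delta> (scl \<tau> (D y)) = 0"
      by (simp add: j D_add D_scl D_one DD \<delta>_scl)
    then have "scl \<tau> (D y) = 0" by (rule \<delta>_inj)
    with j show ?thesis by auto
  qed
  have sq0: "D (x + y) \<cdot> D (x + y) = 0" if "x \<in> E" "y \<in> insert 0 E" for x y
  proof -
    obtain b where b: "D (x + y) \<cdot> D (x + y) = scl b one" using sq by blast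
    then have "b = 0" using neg that unfolding D_def by blast
    with b show ?thesis by simp
  qed
  have "\<exists>x\<in>E. D x \<noteq> 0"
  proof (rule ccontr)
    assume 0: "\<not> ?thesis"
    have "D y = 0" for y
    proof -
      have "y \<in> span E" using E by simp
      then show ?thesis
        by (induction rule: span_induct_alt) (use 0 in \<open>auto simp: D_add D_scl\<close>, simp add: D_def)
    qed
    then have "i \<cdot> y = y \<cdot> i" for y by (simp add: D_def)
    with central_imp_scalar nonscalar show False by blast
  qed
  then obtain x where x: "x \<in> E" "D x \<noteq> 0" by blast
  define u where "u = D x"
  have uu: "u \<cdot> u = 0" using sq0[of x 0] x by (simp add: u_def)
  \<comment> \<open>Polarization: expand \<open>(u + D y)^2 = 0\<close> and remove the two vanishing
    squares.\<close>
  have gen: "u \<cdot> D y + D y \<cdot> u = 0" if "y \<in> E" for y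
    using sq0[of x y] sq0[of y 0] x that uu
    by (simp add: u_def D_add mul_simps) (simp add: add.commute)
  have anti: "u \<cdot> D y + D y \<cdot> u = 0" for y
  proof -
    have "y \<in> span E" using E by simp
    then show ?thesis
    proof (induction rule: span_induct_alt)
      case (step r s y)
      have "u \<cdot> D (scl r s + y) + D (scl r s + y) \<cdot> u =
          scl r (u \<cdot> D s + D s \<cdot> u) + (u \<cdot> D y + D y \<cdot> u)"
        by (simp add: D_add D_scl mul_simps lin_simps algebra_simps)
      with gen step show ?case by simp
    qed (simp add: D_def)
  qed
  have "u \<cdot> y \<cdot> u = 0" for y
  proof -
    \<comment> \<open>Splits \<open>y\<close> into a commutator \<open>w\<close> and a part
      \<open>y - w\<close> that commutes with \<open>i\<close>. The factor \<open>1 / d\<close> is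
      chosen so that \<open>D w = D y\<close>, by \<open>D D = \<delta> D\<close> and
      \<open>\<delta> \<delta> = d\<close>.\<close>
    define w where "w = D (scl (1 / d) (\<delta> y))"
    have "D w = D y"
      using d by (simp add: w_def D_scl D\<delta> DD \<delta>\<delta>)
    then have c: "D (y - w) = 0" by (simp add: D_diff)
    \<comment> \<open>Since \<open>y - w\<close> commutes with \<open>i\<close>, multiplying
      \<open>u = D x\<close> by it gives another commutator, to which \<open>anti\<close>
      applies.\<close>
    have "u \<cdot> (y - w) = D (x \<cdot> (y - w))"
      using c by (simp add: u_def D_def diff_mul mul_assoc)
    then have "u \<cdot> (u \<cdot> (y - w)) + u \<cdot> (y - w) \<cdot> u = 0"
      using anti by simp
    then have 1: "u \<cdot> (y - w) \<cdot> u = 0"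
      using uu by (simp flip: mul_assoc)
    have "u \<cdot> w = - (w \<cdot> u)"
      using anti by (simp add: w_def eq_neg_iff_add_eq_0)
    then have "u \<cdot> w \<cdot> u = 0"
      using uu by (simp add: minus_mul mul_assoc)
    with 1 show ?thesis by (simp add: mul_simps)
  qed
  then have "u = 0" using prime by blast
  with x show False by (simp add: u_def)
qed

text \<open>\<open>U\<close> will hold the basis vectors shifted to trace zero. If no candidate
  works, its elements square to zero and anticommute with each other, so any \<open>u\<close> in
  \<open>U\<close> satisfies \<open>u B u = 0\<close>.\<close>

lemma ex_square_nonzero:
  assumes two: "(2 :: 'a) \<noteq> 0"
    and sq: "\<And>x. x \<in> U \<Longrightarrow> \<exists>r. x \<cdot> x = scl r one"
    and indep: "\<And>x y \<alpha> \<beta> \<gamma>. x \<in> U \<Longrightarrow> y \<in> U \<Longrightarrow> x \<noteq> y \<Longrightarrow>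
      scl \<alpha> x + scl \<beta> y = scl \<gamma> one \<Longrightarrow> \<alpha> = 0 \<and> \<beta> = 0"
    and nonscalar: "\<And>x r. x \<in> U \<Longrightarrow> x \<noteq> scl r one"
    and span: "span (insert one U) = UNIV" and "U \<noteq> {}"
  shows "\<exists>x\<in>U. \<exists>y\<in>insert 0 U. \<exists>a. a \<noteq> 0 \<and> (x + y) \<cdot> (x + y) = scl a one \<and>
    (\<forall>r. x + y \<noteq> scl r one)"
proof (rule ccontr)
  assume neg: "\<not> ?thesis"
  have sq0: "x \<cdot> x = 0" if "x \<in> U" for x
  proof -
    from sq[OF that] obtain r where r: "x \<cdot> x = scl r one" by blast
    with neg that nonscalar[OF that] have "r = 0" by fastforce
    with r show ?thesis by simp
  qed
  have anti: "x \<cdot> y + y \<cdot> x = 0" if xy: "x \<in> U" "y \<in> U" for x y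
  proof (cases "x = y")
    case False
    obtain t n where p: "(x + y) \<cdot> (x + y) = scl t (x + y) + scl n one"
      using quadratic by blast
    obtain t' n' where m: "(x - y) \<cdot> (x - y) = scl t' (x - y) + scl n' one"
      using quadratic by blast
    \<comment> \<open>The squares of \<open>x + y\<close> and \<open>x - y\<close> add up to
      \<open>2 x x + 2 y y = 0\<close>, so the two quadratic equations add up to a linear relation
      modulo scalars.\<close>
    have "scl (t + t') x + scl (t - t') y = scl (- (n + n')) one"
      using arg_cong2[OF p m, of "(+)"] sq0 xy
      by (simp add: mul_simps lin_simps algebra_simps eq_neg_iff_add_eq_0)
    then have "t + t' = 0" "t - t' = 0"
      using indep[OF xy False] by blast+
    then have "2 * t = 0" by (simp add: eq_neg_iff_add_eq_0)
    with two have "t = 0" by simp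
    with p have n: "(x + y) \<cdot> (x + y) = scl n one" by simp
    have "x + y \<noteq> scl r one" for r
      using indep[OF xy False, of 1 1 r] by auto
    with n neg xy have "n = 0" by blast
    with n show ?thesis using sq0 xy by (simp add: mul_simps add.commute)
  qed (simp add: sq0 xy)
  obtain u where u: "u \<in> U" using \<open>U \<noteq> {}\<close> by blast
  have "u \<cdot> y \<cdot> u = 0" for y
  proof -
    have "y \<in> span (insert one U)" using span by simp
    then show ?thesis
    proof (induction rule: span_induct_alt)
      case (step r s y)
      have "u \<cdot> s \<cdot> u = 0"
      proof (cases "s = one")
        case False
        with step anti[OF u, of s] have "u \<cdot> s = - (s \<cdot> u)"
          by (simp add: eq_neg_iff_add_eq_0)
        then show ?thesis using sq0[OF u] by (simp add: minus_mul mul_assoc)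
      qed (simp add: mul_one sq0 u)
      with step show ?case by (simp add: mul_simps)
    qed simp
  qed
  then have "u = 0" using prime by blast
  then show False using nonscalar[OF u, of 0] by simp
qed

text \<open>In characteristic 2 the polar form of squaring is the commutator. Scalar squares on a
  spanning set therefore make all commutators scalar, which forces commutativity.\<close>

lemma char_2_ex_square_nonscalar:
  assumes two: "(2 :: 'a) = 0" and span: "span E = UNIV"
  shows "\<exists>x\<in>E. \<forall>r. x \<cdot> x \<noteq> scl r one"
proof (rule ccontr)
  assume "\<not> ?thesis"
  then have sq: "\<exists>r. x \<cdot> x = scl r one" if "x \<in> E" for x
    using that by blast
  have neg: "- x = x" for x :: 'b
  proof -
    have "x + x = scl (1 + 1) x" by (simp only: lin_simps scale_one)
    then show ?thesis using two by (simp add: neg_eq_iff_add_eq_0)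
  qed
  define K where "K x y = x \<cdot> y + y \<cdot> x" for x y
  have K_add: "K x (y + z) = K x y + K x z" "K (x + y) z = K x z + K y z"
    and K_scl: "K x (scl r y) = scl r (K x y)" "K (scl r x) y = scl r (K x y)"
    for x y z r
    by (simp_all add: K_def mul_simps lin_simps algebra_simps)
  have K_0: "K x 0 = 0" "K 0 x = 0" for x
    by (simp_all add: K_def)
  let ?F = "range (\<lambda>r. scl r one)"
  have F_add: "x + y \<in> ?F" if "x \<in> ?F" "y \<in> ?F" for x y
    using that by (auto simp flip: scale_left_distrib)
  have F_scl: "scl r x \<in> ?F" if "x \<in> ?F" for r x
    using that by auto
  have F0: "0 \<in> ?F" by (metis rangeI scale_zero_left)
  have gen: "K x y \<in> ?F" if xy: "x \<in> E" "y \<in> E" for x y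
  proof -
    obtain r s where rs: "x \<cdot> x = scl r one" "y \<cdot> y = scl s one"
      using sq xy by blast
    obtain t n where "(x + y) \<cdot> (x + y) = scl t (x + y) + scl n one"
      using quadratic by blast
    then have K: "K x y = scl t (x + y) + scl (n - r - s) one"
      using rs by (simp add: K_def mul_simps lin_simps algebra_simps)
    \<comment> \<open>Because \<open>x x\<close> is scalar, both sides equal \<open>x y x\<close>
      plus \<open>x x\<close> times \<open>y\<close>. Comparing with the expression \<open>K\<close>
      leaves either a zero linear coefficient or commuting \<open>x\<close> and
      \<open>y\<close>.\<close>
    have "x \<cdot> K x y = K x y \<cdot> x"
      using rs by (simp add: K_def mul_simps flip: mul_assoc) (simp add: mul_assoc rs mul_simps)
    then have "scl t (x \<cdot> y) = scl t (y \<cdot> x)"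
      by (simp add: K mul_simps lin_simps)
    then have "t = 0 \<or> x \<cdot> y = y \<cdot> x" by auto
    then show ?thesis
    proof
      assume "x \<cdot> y = y \<cdot> x"
      then have "K x y = 0" using neg[of "y \<cdot> x"] by (simp add: K_def eq_neg_iff_add_eq_0[symmetric])
      then show ?thesis using F0 by simp
    qed (use K in auto)
  qed
  have gen': "K x y \<in> ?F" if "x \<in> E" for x y
  proof -
    have "y \<in> span E" using span by simp
    then show ?thesis
      by (induction rule: span_induct_alt)
        (use gen that F_add F_scl F0 in \<open>auto simp del: image_iff simp: K_add K_scl K_0\<close>)
  qed
  have all: "K x y \<in> ?F" for x y
  proof -
    have "x \<in> span E" using span by simp
    then show ?thesis
      by (induction rule: span_induct_alt)
        (use gen' F_add F_scl F0 in \<open>auto simp del: image_iff simp: K_add K_scl K_0\<close>)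
  qed
  have "x \<cdot> y = y \<cdot> x" for x y
  proof (cases "x \<in> ?F")
    case False
    obtain c where c: "K x y = scl c one" using all by blast
    \<comment> \<open>The left side is scalar like every value of \<open>K\<close>, while the right
      side is \<open>c\<close> times the nonscalar \<open>x\<close>; hence
      \<open>c = 0\<close>.\<close>
    have "K x (x \<cdot> y) = x \<cdot> K x y"
      by (simp add: K_def mul_simps mul_assoc)
    then have "scl c x \<in> ?F" using all c by (metis mul_one mul_scl)
    then have "c = 0"
      using False F_scl[of "scl c x" "1 / c"] by (cases "c = 0") auto
    with c show ?thesis using neg[of "y \<cdot> x"] by (simp add: K_def eq_neg_iff_add_eq_0[symmetric])
  qed (auto simp: mul_simps)
  with noncommutative show False by blast
qed

end

section \<open>The algebra (a,b/F)\<close>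

lemma two_eq_0_iff_CHAR: "(2 :: 'a::field) = 0 \<longleftrightarrow> CHAR('a) = 2"
proof
  assume "(2 :: 'a) = 0"
  then have "CHAR('a) dvd 2"
    by (metis of_nat_eq_0_iff_char_dvd of_nat_numeral)
  then have "CHAR('a) \<le> 2" "CHAR('a) \<noteq> 0"
    by (auto dest: dvd_imp_le intro!: gr0I)
  moreover have "CHAR('a) \<noteq> 1" by simp
  ultimately show "CHAR('a) = 2" by linarith
qed (metis of_nat_CHAR of_nat_numeral)

context assoc_algebra
begin

definition quat_gens :: "'a \<Rightarrow> 'a \<Rightarrow> 'b \<Rightarrow> 'b \<Rightarrow> bool" where
  "quat_gens a b i j \<longleftrightarrow> quat_params a b \<and> j \<cdot> j = scl b one \<and>
    (if CHAR('a) = 2 then i \<cdot> i + i = scl a one \<and> j \<cdot> i = (i + one) \<cdot> j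
     else i \<cdot> i = scl a one \<and> j \<cdot> i = - (i \<cdot> j))"

definition quat_map :: "'b \<Rightarrow> 'b \<Rightarrow> 'a^4 \<Rightarrow> 'b" where
  "quat_map i j v = scl (v $ 1) one + scl (v $ 2) i + scl (v $ 3) j + scl (v $ 4) (i \<cdot> j)"

text \<open>The relations are oriented as rewrite rules that move \<open>i\<close> to the left of
  \<open>j\<close> and reduce squares. The versions \<open>r'\<close> with a trailing factor are
  required because products are nested to the right.\<close>

lemma quat_map_mult:
  assumes "quat_gens a b i j"
  shows "quat_map i j (table_mult (quat_table a b) v w) = quat_map i j v \<cdot> quat_map i j w"
proof (cases "CHAR('a) = 2")
  case True
  have double: "x + x = 0" "x + (x + y) = y" for x y :: 'b
  proof -
    have "x + x = scl (1 + 1) x" by (simp only: lin_simps scale_one)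
    then show "x + x = 0" using True two_eq_0_iff_CHAR[where 'a='a] by simp
    then show "x + (x + y) = y" by (simp flip: add.assoc)
  qed
  have neg: "- x = x" for x :: 'b
    using double(1)[of x] by (simp add: neg_eq_iff_add_eq_0)
  have g: "i \<cdot> i + i = scl a one" "j \<cdot> j = scl b one" "j \<cdot> i = (i + one) \<cdot> j"
    using assms True by (auto simp: quat_gens_def)
  have "i \<cdot> i = scl a one - i" using g(1) by (simp add: eq_diff_eq)
  then have "i \<cdot> i = scl a one + i" using neg[of i] by (metis diff_conv_add_uminus)
  with g have r: "i \<cdot> i = scl a one + i" "j \<cdot> j = scl b one" "j \<cdot> i = i \<cdot> j + j"
    by (simp_all add: mul_simps)
  have r': "i \<cdot> (i \<cdot> x) = scl a x + i \<cdot> x" "j \<cdot> (j \<cdot> x) = scl b x" "j \<cdot> (i \<cdot> x) = i \<cdot> (j \<cdot> x) + j \<cdot> x" for x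
    using r by (simp_all add: mul_simps flip: mul_assoc)
  show ?thesis
    using True
    by (simp add: quat_map_def table_mult_def sum_4 quat_table_def mul_simps mul_assoc r r' lin_simps algebra_simps double)
next
  case False
  have r: "i \<cdot> i = scl a one" "j \<cdot> j = scl b one" "j \<cdot> i = - (i \<cdot> j)"
    using assms False by (auto simp: quat_gens_def)
  have r': "i \<cdot> (i \<cdot> x) = scl a x" "j \<cdot> (j \<cdot> x) = scl b x" "j \<cdot> (i \<cdot> x) = - (i \<cdot> (j \<cdot> x))" for x
    using r by (simp_all add: mul_simps flip: mul_assoc)
  show ?thesis
    using False
    by (simp add: quat_map_def table_mult_def sum_4 quat_table_def mul_simps mul_assoc r r' lin_simps algebra_simps)
qed

end

text \<open>From a nonzero element of \<open>I\<close>, split off the parts in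
  \<open>F + F i\<close> and \<open>(F + F i) j\<close>, move the second into \<open>F + F i\<close>
  by a factor \<open>j\<close>, and then use \<open>j\<close> or \<open>i\<close> to reach a nonzero
  scalar.\<close>

lemma quat_table_simple:
  fixes a b :: "'a::field"
  assumes ab: "quat_params a b" and I: "two_sided_ideal (table_mult (quat_table a b)) I"
  shows "I = {0} \<or> I = UNIV"
proof -
  let ?m = "table_mult (quat_table a b)"
  let ?i = "axis 2 1 :: 'a^4" and ?j = "axis 3 1 :: 'a^4"
  interpret assoc_algebra "(*s)" ?m "axis 1 1"
    using quat_table_algebra unfolding multiplication_table_def .
  note coord = vec_eq_iff forall_4 table_mult_def sum_4 quat_table_def axis_def
  have I_mul: "?m x y \<in> I" "?m y x \<in> I" if "x \<in> I" for x y
    using I that by (auto simp: two_sided_ideal_def)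
  have I_diff: "x - y \<in> I" if "x \<in> I" "y \<in> I" for x y
    using I that by (auto simp: two_sided_ideal_def)
  have I_0: "0 \<in> I"
    using I by (auto simp: two_sided_ideal_def)
  have I_add: "x + y \<in> I" if "x \<in> I" "y \<in> I" for x y
    using I_diff[OF that(1) I_diff[OF I_0 that(2)]] by simp
  have I_scale: "r *s x \<in> I" if "x \<in> I" for r x
  proof -
    have "r *s x = ?m (r *s axis 1 1) x" by (simp add: mul_simps)
    then show ?thesis using I_mul(2)[OF that] by simp
  qed
  have two: "(2 :: 'a) \<noteq> 0" if "CHAR('a) \<noteq> 2"
    using two_eq_0_iff_CHAR[where 'a='a] that by blast
  have b: "b \<noteq> 0" and a: "CHAR('a) \<noteq> 2 \<Longrightarrow> a \<noteq> 0"
    using ab by (auto simp: quat_params_def)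
  have UNIV: "I = UNIV" if "vector [r, 0, 0, 0] \<in> I" "r \<noteq> 0" for r
  proof -
    have "x = ?m (vector [r, 0, 0, 0]) ((1 / r) *s x)" for x
    proof -
      have "vector [r, 0, 0, 0] = r *s (axis 1 1 :: 'a^4)"
        by (simp add: vec_eq_iff forall_4 axis_def)
      then show ?thesis using that(2) by (simp add: mul_simps)
    qed
    then show ?thesis using I_mul(1)[OF that(1)] by (metis UNIV_eq_I)
  qed
  show ?thesis
  proof (cases "I = {0}")
    case False
    then obtain x where x: "x \<in> I" "x \<noteq> 0" using I_0 by blast
    have "\<exists>p q. vector [p, q, 0, 0] \<in> I \<and> (p \<noteq> 0 \<or> q \<noteq> 0)"
    proof -
      have "vector [x $ 1, x $ 2, 0, 0] \<in> I \<and> vector [0, 0, x $ 3, x $ 4] \<in> I"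
      proof (cases "CHAR('a) = 2")
        case True
        \<comment> \<open>Commutation with \<open>i\<close> kills \<open>F + F i\<close> and fixes
          \<open>(F + F i) j\<close> in characteristic 2.\<close>
        have "vector [0, 0, x $ 3, x $ 4] = ?m ?i x - ?m x ?i"
          using True two_eq_0_iff_CHAR[where 'a='a] by (simp add: coord algebra_simps)
        then have w: "vector [0, 0, x $ 3, x $ 4] \<in> I"
          using I_diff I_mul x by metis
        have "vector [x $ 1, x $ 2, 0, 0] = x - vector [0, 0, x $ 3, x $ 4]"
          by (simp add: coord)
        with w show ?thesis using I_diff x by metis
      next
        case False
        \<comment> \<open>\<open>x\<close> goes to \<open>i x i\<close>, which is \<open>a x\<close>
          on \<open>F + F i\<close> and \<open>- a x\<close> on \<open>(F + F i) j\<close>; the two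
          parts are its eigenspace components.\<close>
        have "vector [x $ 1, x $ 2, 0, 0] = (1 / (2 * a)) *s (a *s x + ?m ?i (?m x ?i))"
          using False two a by (simp add: coord algebra_simps)
        moreover have "vector [0, 0, x $ 3, x $ 4] = (1 / (2 * a)) *s (a *s x - ?m ?i (?m x ?i))"
          using False two a by (simp add: coord algebra_simps)
        ultimately show ?thesis
          using I_scale I_add I_diff I_mul x by metis
      qed
      moreover have "vector [b * x $ 3, b * x $ 4, 0, 0] = ?m (vector [0, 0, x $ 3, x $ 4]) ?j"
        by (simp add: coord)
      ultimately have "vector [x $ 1, x $ 2, 0, 0] \<in> I" "vector [b * x $ 3, b * x $ 4, 0, 0] \<in> I"
        using I_mul by metis+
      moreover have "x $ 1 \<noteq> 0 \<or> x $ 2 \<noteq> 0 \<or> b * x $ 3 \<noteq> 0 \<or> b * x $ 4 \<noteq> 0"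
        using x b by (auto simp: vec_eq_iff forall_4)
      ultimately show ?thesis by blast
    qed
    then obtain p q where y: "vector [p, q, 0, 0] \<in> I" and pq: "p \<noteq> 0 \<or> q \<noteq> 0" by blast
    show ?thesis
    proof (cases "CHAR('a) = 2")
      case True
      \<comment> \<open>\<open>j (p + q i) j = b (p + q (i + 1))\<close>. If \<open>q = 0\<close>,
        the vector \<open>y\<close> is already a nonzero scalar.\<close>
      have "vector [b * q, 0, 0, 0] = ?m ?j (?m (vector [p, q, 0, 0]) ?j) - b *s vector [p, q, 0, 0]"
        using True by (simp add: coord algebra_simps)
      then have "vector [b * q, 0, 0, 0] \<in> I"
        using y I_diff I_mul I_scale by metis
      with UNIV b y pq show ?thesis by (metis mult_eq_0_iff)
    next
      case False
      \<comment> \<open>\<open>j (p + q i) j = b (p - q i)\<close>, so the sum cancels the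
        \<open>i\<close>-coordinate.\<close>
      have "vector [2 * b * p, 0, 0, 0] = ?m ?j (?m (vector [p, q, 0, 0]) ?j) + b *s vector [p, q, 0, 0]"
        using False by (simp add: coord algebra_simps)
      then have p: "vector [2 * b * p, 0, 0, 0] \<in> I"
        using y I_add I_mul I_scale by metis
      have "vector [a * q, 0, 0, 0] = ?m ?i (vector [0, q, 0, 0])"
        using False by (simp add: coord)
      then have q: "vector [a * q, 0, 0, 0] \<in> I" if "p = 0"
        using y I_mul that by metis
      show ?thesis
        using UNIV[OF p] UNIV[OF q] pq two[OF False] a[OF False] b by (cases "p = 0") auto
    qed
  qed simp
qed

text \<open>Commuting with \<open>i\<close> removes the coordinates at \<open>j\<close> and
  \<open>ij\<close>; commuting with \<open>j\<close> then removes the one at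
  \<open>i\<close>.\<close>

lemma quat_table_center:
  fixes a b :: "'a::field"
  assumes ab: "quat_params a b"
  shows "center (table_mult (quat_table a b)) = range (\<lambda>r. r *s axis 1 1)"
proof (intro equalityI subsetI)
  interpret assoc_algebra "(*s)" "table_mult (quat_table a b)" "axis 1 1"
    using quat_table_algebra unfolding multiplication_table_def .
  fix z :: "'a^4"
  {
    assume "z \<in> range (\<lambda>r. r *s axis 1 1)"
    then show "z \<in> center (table_mult (quat_table a b))"
      by (auto simp: center_def mul_simps)
  next
    assume "z \<in> center (table_mult (quat_table a b))"
    then have i: "table_mult (quat_table a b) z (axis 2 1) = table_mult (quat_table a b) (axis 2 1) z"
      and j: "table_mult (quat_table a b) z (axis 3 1) = table_mult (quat_table a b) (axis 3 1) z"
      by (auto simp: center_def)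
    have two: "(2 :: 'a) \<noteq> 0" if "CHAR('a) \<noteq> 2"
      using two_eq_0_iff_CHAR[where 'a='a] that by blast
    have b: "b \<noteq> 0" and a: "CHAR('a) \<noteq> 2 \<Longrightarrow> a \<noteq> 0"
      using ab by (auto simp: quat_params_def)
    have neg: "x = - x \<longleftrightarrow> x = 0" "- x = x \<longleftrightarrow> x = 0" if "CHAR('a) \<noteq> 2" for x :: 'a
      using two[OF that] by (auto simp: eq_neg_iff_add_eq_0 neg_eq_iff_add_eq_0 simp flip: mult_2)
    have "z $ 2 = 0 \<and> z $ 3 = 0 \<and> z $ 4 = 0"
      using i j a b neg
      by (cases "CHAR('a) = 2")
        (auto simp: vec_eq_iff forall_4 table_mult_def sum_4 quat_table_def axis_def)
    then have "z = z $ 1 *s axis 1 1"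
      by (simp add: vec_eq_iff forall_4 axis_def)
    then show "z \<in> range (\<lambda>r. r *s axis 1 1)" by blast
  }
qed

lemma quat_table_central_simple:
  assumes "quat_params a b"
  shows "central_simple (*s) (table_mult (quat_table a b)) (axis 1 1)"
proof -
  have "axis 1 1 \<noteq> (0 :: 'a::field^4)" by (simp add: axis_eq_0_iff)
  then have "(UNIV :: ('a^4) set) \<noteq> {0}" by blast
  then show ?thesis
    using quat_table_algebra quat_table_center[OF assms] quat_table_simple[OF assms]
    by (simp add: central_simple_def multiplication_table_def)
qed

lemma algebra_iso_central_simple:
  fixes scl1 :: "'a::field \<Rightarrow> 'b::ab_group_add \<Rightarrow> 'b"
    and scl2 :: "'a \<Rightarrow> 'c::ab_group_add \<Rightarrow> 'c"
  assumes "assoc_algebra scl1 mul1 one1" and iso: "algebra_iso scl1 mul1 one1 scl2 mul2 one2 f"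
    and cs: "central_simple scl2 mul2 one2"
  shows "central_simple scl1 mul1 one1"
proof -
  interpret A1: assoc_algebra scl1 mul1 one1 by fact
  interpret Vector_Spaces.linear scl1 scl2 f
    using iso by (simp add: algebra_iso_def)
  have bij: "bij f" and f_one: "f one1 = one2" and f_mul: "f (mul1 x y) = mul2 (f x) (f y)" for x y
    using iso by (auto simp: algebra_iso_def)
  have inj: "f x = f y \<longleftrightarrow> x = y" for x y
    using bij by (auto simp: bij_def inj_def)
  have surj: "\<exists>x. y = f x" for y
    using bij by (auto simp: bij_def surj_def)
  have center: "z \<in> center mul1 \<longleftrightarrow> f z \<in> center mul2" for z
  proof -
    have "(\<forall>y. mul2 (f z) y = mul2 y (f z)) \<longleftrightarrow> (\<forall>x. mul2 (f z) (f x) = mul2 (f x) (f z))"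
      using bij_is_surj[OF bij] by (auto simp: surj_def) (metis surj)
    then have "f z \<in> center mul2 \<longleftrightarrow> (\<forall>x. mul2 (f z) (f x) = mul2 (f x) (f z))"
      by (simp add: center_def)
    then show ?thesis by (simp add: center_def inj flip: f_mul)
  qed
  have center_eq: "center mul1 = range (\<lambda>r. scl1 r one1)"
  proof (intro set_eqI)
    fix z
    have "z \<in> center mul1 \<longleftrightarrow> (\<exists>r. f z = scl2 r (f one1))"
      unfolding center f_one using cs by (auto simp: central_simple_def)
    also have "\<dots> \<longleftrightarrow> z \<in> range (\<lambda>r. scl1 r one1)"
      by (auto simp: inj simp flip: scale)
    finally show "z \<in> center mul1 \<longleftrightarrow> z \<in> range (\<lambda>r. scl1 r one1)" .
  qed
  have nontrivial: "(UNIV :: 'b set) \<noteq> {0}"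
  proof
    assume "(UNIV :: 'b set) = {0}"
    then have "y = 0" for y :: 'c
      using surj[of y] zero by (metis UNIV_I singletonD)
    then show False using cs by (auto simp: central_simple_def)
  qed
  have simple: "I = {0} \<or> I = UNIV" if I: "two_sided_ideal mul1 I" for I
  proof -
    have "two_sided_ideal mul2 (f ` I)"
      unfolding two_sided_ideal_def
    proof (intro conjI ballI allI)
      show "0 \<in> f ` I" using I zero by (metis imageI two_sided_ideal_def)
    next
      fix x y assume "x \<in> f ` I" "y \<in> f ` I"
      then show "x - y \<in> f ` I"
        using I by (auto simp: two_sided_ideal_def simp flip: diff)
    next
      fix x b assume "x \<in> f ` I"
      then obtain x' where x': "x' \<in> I" "x = f x'" by blast
      obtain b' where b': "b = f b'" using surj by blast
      show "mul2 b x \<in> f ` I" "mul2 x b \<in> f ` I"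
        using I x' b' by (auto simp: two_sided_ideal_def simp flip: f_mul)
    qed
    then have "f ` I = {0} \<or> f ` I = UNIV"
      using cs by (simp add: central_simple_def)
    then show ?thesis
    proof
      assume 0: "f ` I = {0}"
      have "x = 0" if "x \<in> I" for x
        using 0 that inj[of x 0] by (auto simp: zero)
      moreover have "0 \<in> I" using I by (simp add: two_sided_ideal_def)
      ultimately show ?thesis by auto
    next
      assume "f ` I = UNIV"
      then have "x \<in> I" for x using inj by (metis UNIV_I imageE)
      then show ?thesis by blast
    qed
  qed
  show ?thesis
    using assms(1) center_eq nontrivial simple unfolding central_simple_def by blast
qed

text \<open>The columns are \<open>1, i, j, ij\<close>, so this is the matrix of
  \<open>quat_map\<close>, which leads into \<open>B\<close>. The isomorphism to be output is its
  inverse.\<close>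

definition quat_matrix :: "'a::field^4^4^4 \<Rightarrow> 'a^4 \<Rightarrow> 'a^4 \<Rightarrow> 'a^4^4" where
  "quat_matrix c i j = (\<chi> r k. if k = 1 then axis 1 1 $ r else if k = 2 then i $ r
    else if k = 3 then j $ r else table_mult c i j $ r)"

text \<open>Determinants are polynomials in the entries, so this inverse is computed without any
  pivot search. It is total: a zero determinant gives the zero matrix.\<close>

definition cramer_inverse :: "'a::field^'n^'n \<Rightarrow> 'a^'n^'n" where
  "cramer_inverse N = (\<chi> k l. det (\<chi> r s. if s = k then axis l 1 $ r else N $ r $ s) / det N)"

lemma cramer_inverse:
  assumes "det N \<noteq> 0"
  shows "N ** cramer_inverse N = mat 1" "cramer_inverse N ** N = mat 1"
proof -
  have "N *v column l (cramer_inverse N) = axis l 1" for l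
    unfolding cramer[OF assms] by (simp add: vec_eq_iff column_def cramer_inverse_def)
  then have "(N ** cramer_inverse N) $ r $ l = mat 1 $ r $ l" for r l
    by (simp add: vec_eq_iff matrix_matrix_mult_def matrix_vector_mult_def column_def mat_def axis_def)
  then show "N ** cramer_inverse N = mat 1" by (simp add: vec_eq_iff)
  then show "cramer_inverse N ** N = mat 1" by (simp add: matrix_left_right_inverse)
qed

text \<open>The kernel of \<open>quat_map\<close> is an ideal of the simple algebra
  \<open>(a,b/F)\<close> that misses 1, hence zero. The square matrix is then invertible, and its
  inverse inherits multiplicativity.\<close>

lemma quat_gens_imp_iso:
  assumes c: "multiplication_table c"
    and gens: "assoc_algebra.quat_gens (*s) (table_mult c) (axis 1 1) a b i j"
  shows "algebra_iso (*s) (table_mult c) (axis 1 1) (*s) (table_mult (quat_table a b)) (axis 1 1)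
    ((*v) (cramer_inverse (quat_matrix c i j)))"
proof -
  interpret assoc_algebra "(*s)" "table_mult c" "axis 1 1"
    using c unfolding multiplication_table_def .
  let ?N = "quat_matrix c i j"
  let ?M = "cramer_inverse ?N"
  let ?q = "table_mult (quat_table a b)"
  have N: "?N *v v = quat_map i j v" for v
    by (simp add: vec_eq_iff quat_map_def quat_matrix_def matrix_vector_mult_def sum_4 mult.commute)
  have mult: "?N *v ?q v w = table_mult c (?N *v v) (?N *v w)" for v w
    unfolding N using quat_map_mult[OF gens] .
  have N_one: "?N *v axis 1 1 = axis 1 1"
    by (simp add: N quat_map_def) (simp add: axis_def)
  have "two_sided_ideal ?q {v. ?N *v v = 0}"
    by (auto simp: two_sided_ideal_def mult vec.diff)
  then have "{v. ?N *v v = 0} = {0} \<or> {v. ?N *v v = 0} = UNIV"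
    using gens by (intro quat_table_simple) (simp_all add: quat_gens_def)
  moreover have "axis 1 1 \<noteq> (0 :: 'a^4)" by (simp add: axis_eq_0_iff)
  ultimately have "{v. ?N *v v = 0} = {0}"
    using N_one by (metis (mono_tags, lifting) UNIV_I mem_Collect_eq)
  then have "inj ((*v) ?N)"
    by (auto simp: vec.inj_iff_eq_0)
  then have "det ?N \<noteq> 0"
    by (metis invertible_det_nz invertible_left_inverse matrix_left_invertible_injective)
  note inverse = cramer_inverse[OF this]
  have MN: "?M *v (?N *v v) = v" and NM: "?N *v (?M *v v) = v" for v
    using inverse by (simp_all add: matrix_vector_mul_assoc)
  have "?M *v table_mult c x y = ?q (?M *v x) (?M *v y)" for x y
    using MN[of "?q (?M *v x) (?M *v y)"] by (simp add: mult NM)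
  moreover have "?M *v axis 1 1 = axis 1 1"
    using MN[of "axis 1 1"] by (simp add: N_one)
  moreover have "bij ((*v) ?M)"
    using MN NM by (metis bijI')
  ultimately show ?thesis
    by (simp add: algebra_iso_def)
qed

text \<open>Soundness of the test: central simplicity is pulled back from \<open>(a,b/F)\<close>
  along the isomorphism.\<close>

lemma quat_gens_imp_quaternion_algebra:
  assumes c: "multiplication_table c"
    and gens: "assoc_algebra.quat_gens (*s) (table_mult c) (axis 1 1) a b i j"
  shows "quaternion_algebra (*s) (table_mult c) (axis 1 1)"
proof -
  interpret assoc_algebra "(*s)" "table_mult c" "axis 1 1"
    using c unfolding multiplication_table_def .
  have "quat_params a b"
    using gens by (simp add: quat_gens_def)
  from algebra_iso_central_simple[OF _ quat_gens_imp_iso[OF assms] quat_table_central_simple[OF this]]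
  show ?thesis
    using c by (simp add: quaternion_algebra_def multiplication_table_def vec_dim_card
        del: vec.dim_UNIV)
qed

section \<open>Finitely many candidates for the generators\<close>

text \<open>
  For a quaternion algebra this is the reduced trace, since \<open>e k\<close> squares to
  \<open>trd (e k) *s e k - nrd (e k) *s e 1\<close>. For other tables it has no meaning, and division by a
  zero trace in \<open>normalize_gen\<close> gives the candidate 0; both are caught by testing the relations.
\<close>

definition trace_form :: "'a::field^4^4^4 \<Rightarrow> 'a^4 \<Rightarrow> 'a" where
  "trace_form c x = (\<Sum>k\<in>UNIV. x $ k * (if k = 1 then 2 else c $ k $ k $ k))"

text \<open>Trace 1 is needed for \<open>i i + i\<close> to be scalar in characteristic 2, and trace
  0 for \<open>i i\<close> to be scalar otherwise.\<close>

definition normalize_gen :: "'a::field^4^4^4 \<Rightarrow> 'a^4 \<Rightarrow> 'a^4" where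
  "normalize_gen c x = (if CHAR('a) = 2 then (1 / trace_form c x) *s x
    else x - (trace_form c x / 2) *s axis 1 1)"

definition commutator :: "'a::field^4^4^4 \<Rightarrow> 'a^4 \<Rightarrow> 'a^4 \<Rightarrow> 'a^4" where
  "commutator c x y = table_mult c x y - table_mult c y x"

lemma cart_basis_eq: "cart_basis = range (\<lambda>k. axis k 1)"
  by (auto simp: cart_basis_def)

definition std_sums :: "('a::field^4) set" where
  "std_sums = (\<Union>x\<in>cart_basis. \<Union>y\<in>insert 0 cart_basis. {x + y})"

lemma finite_std_sums: "finite std_sums"
  by (simp add: std_sums_def cart_basis_eq)

lemma trace_form_axis: "k \<noteq> 1 \<Longrightarrow> trace_form c (axis k 1) = c $ k $ k $ k"
proof -
  assume "k \<noteq> 1"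
  then have "trace_form c (axis k 1) = (\<Sum>l\<in>UNIV. if l = k then c $ k $ k $ k else 0)"
    unfolding trace_form_def by (intro sum.cong) (auto simp: axis_def)
  then show ?thesis by simp
qed

lemma trace_form_add: "trace_form c (x + y) = trace_form c x + trace_form c y"
  by (simp add: trace_form_def algebra_simps sum.distrib)

lemma normalize_gen_add:
  fixes c :: "'a::field^4^4^4"
  assumes "CHAR('a) \<noteq> 2"
  shows "normalize_gen c (x + y) = normalize_gen c x + normalize_gen c y"
  using assms by (simp add: normalize_gen_def trace_form_add vec_eq_iff algebra_simps add_divide_distrib)

lemma quaternion_algebra_imp_quat_gens:
  fixes c :: "'a::field^4^4^4"
  assumes "quaternion_algebra (*s) (table_mult c) (axis 1 1)"
  shows "\<exists>x\<in>std_sums. \<exists>y\<in>std_sums. \<exists>a b. assoc_algebra.quat_gens (*s) (table_mult c) (axis 1 1) a b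
    (normalize_gen c x) (commutator c (normalize_gen c x) y)"
proof -
  have cs: "central_simple (*s) (table_mult c) (axis 1 1)"
    using assms by (simp add: quaternion_algebra_def)
  then interpret assoc_algebra "(*s)" "table_mult c" "axis 1 1"
    by (simp add: central_simple_def)
  interpret quaternion_alg "(*s)" "table_mult c" "axis 1 1"
    using cs assms by unfold_locales (auto simp: central_simple_def quaternion_algebra_def)
  define e where "e k = (axis k 1 :: 'a^4)" for k
  have sq: "\<exists>m. table_mult c (e k) (e k) = c $ k $ k $ k *s e k + m *s axis 1 1" if "k \<noteq> 1" for k
  proof -
    obtain t m where tm: "table_mult c (e k) (e k) = t *s e k + m *s axis 1 1"
      using quadratic by blast
    \<comment> \<open>Reads the trace off the table: as \<open>k\<close> is not 1, the scalar term
      does not contribute to coordinate \<open>k\<close>.\<close>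
    have "table_mult c (e k) (e k) $ k = c $ k $ k $ k"
      by (simp add: e_def table_mult_axis) (simp add: axis_def if_distrib[of "\<lambda>x. _ * x"] cong: if_cong)
    moreover have "(t *s e k + m *s axis 1 1) $ k = t"
      using that by (simp add: e_def axis_def)
    ultimately have "t = c $ k $ k $ k" using tm by simp
    with tm show ?thesis by blast
  qed
  have comm: "\<exists>y\<in>std_sums. \<exists>b. b \<noteq> 0 \<and>
      table_mult c (commutator c i y) (commutator c i y) = b *s axis 1 1"
    if "table_mult c i i = t *s i - n *s axis 1 1" "t * t - 4 * n \<noteq> 0" "\<And>r. i \<noteq> r *s axis 1 1" for i t n
    using ex_commutator_square_nonzero[OF that span_cart_basis]
    by (auto simp: std_sums_def commutator_def)
  show ?thesis
  proof (cases "CHAR('a) = 2")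
    case True
    then have two: "(2 :: 'a) = 0" by (simp add: two_eq_0_iff_CHAR)
    obtain k where k: "\<And>r. table_mult c (e k) (e k) \<noteq> r *s axis 1 1"
      using char_2_ex_square_nonscalar[OF two span_cart_basis] by (auto simp: cart_basis_eq e_def)
    have "k \<noteq> 1"
      using k[of 1] by (auto simp: e_def mul_simps)
    from sq[OF this] obtain m
      where m: "table_mult c (e k) (e k) = c $ k $ k $ k *s e k + m *s axis 1 1" by blast
    define t where "t = c $ k $ k $ k"
    have t: "t \<noteq> 0"
      using m k[of m] by (auto simp: t_def)
    define i where "i = normalize_gen c (e k)"
    have i: "i = (1 / t) *s e k"
      using True trace_form_axis[OF \<open>k \<noteq> 1\<close>, of c] by (simp add: i_def normalize_gen_def e_def t_def)
    \<comment> \<open>Dividing \<open>e_k^2 = t e_k + m\<close> by \<open>t^2\<close> gives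
      \<open>i^2 = i + m / t^2\<close>.\<close>
    define a where "a = m / (t * t)"
    have ii: "table_mult c i i = 1 *s i - (- a) *s axis 1 1"
      using t by (simp add: i mul_simps m a_def vec_eq_iff field_simps flip: t_def)
    have add_self: "x + x = 0" for x :: "'a^4"
      using char_2_add_self[OF True] by (simp add: vec_eq_iff)
    have neg: "- x = x" for x :: "'a^4"
      using add_self[of x] by (simp add: neg_eq_iff_add_eq_0)
    \<comment> \<open>Trace 1 and norm \<open>- a\<close>; the discriminant is 1 because
      \<open>4 = 0\<close>.\<close>
    have "1 * 1 - 4 * (- a) = 1 + 2 * (2 * a)" by simp
    then have disc: "1 * 1 - 4 * (- a) \<noteq> 0" using two by (metis add.right_neutral mult_zero_left zero_neq_one)
    have "i \<noteq> r *s axis 1 1" for r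
    proof
      assume "i = r *s axis 1 1"
      then have "i $ k = 0" using \<open>k \<noteq> 1\<close> by (simp add: axis_def)
      then show False using t by (simp add: i e_def)
    qed
    from comm[OF ii disc this] obtain y b where y: "y \<in> std_sums" "b \<noteq> 0"
      and jj: "table_mult c (commutator c i y) (commutator c i y) = b *s axis 1 1" by blast
    have "table_mult c (commutator c i y) i = commutator c i y - table_mult c i (commutator c i y)"
      using commutator_mul[OF ii, of y] by (simp add: commutator_def)
    also have "\<dots> = table_mult c (i + axis 1 1) (commutator c i y)"
      using neg[of "table_mult c i (commutator c i y)"] by (simp add: mul_simps)
    finally have ji: "table_mult c (commutator c i y) i = table_mult c (i + axis 1 1) (commutator c i y)" .
    have "table_mult c i i + i = a *s axis 1 1"
      using ii add_self[of i] by simp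
    then have "quat_gens a b i (commutator c i y)"
      using jj ji y True by (simp add: quat_gens_def quat_params_def)
    moreover have "e k \<in> std_sums"
      by (force simp: std_sums_def e_def cart_basis_eq)
    ultimately show ?thesis using y unfolding i_def by blast
  next
    case False
    then have two: "(2 :: 'a) \<noteq> 0" by (simp add: two_eq_0_iff_CHAR)
    define u where "u k = normalize_gen c (e k)" for k
    have u: "u k = e k - (c $ k $ k $ k / 2) *s axis 1 1" if "k \<noteq> 1" for k
      using trace_form_axis[OF that, of c] False by (simp add: u_def normalize_gen_def e_def)
    \<comment> \<open>The three basis vectors other than \<open>e 1\<close>, shifted to trace
      zero.\<close>
    define U where "U = u ` (- {1})"
    have U_sq: "\<exists>r. table_mult c x x = r *s axis 1 1" if "x \<in> U" for x
    proof -
      from that obtain k where k: "k \<noteq> 1" "x = u k" by (auto simp: U_def)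
      from sq[OF k(1)] obtain m where m: "table_mult c (e k) (e k) = c $ k $ k $ k *s e k + m *s axis 1 1"
        by blast
      have "table_mult c x x = (m + c $ k $ k $ k / 2 * (c $ k $ k $ k / 2)) *s axis 1 1"
        using two by (simp add: u k mul_simps m lin_simps vec_eq_iff field_simps)
      then show ?thesis by blast
    qed
    have U_indep: "\<alpha> = 0 \<and> \<beta> = 0"
      if xy: "x \<in> U" "y \<in> U" "x \<noteq> y" and eq: "\<alpha> *s x + \<beta> *s y = \<gamma> *s axis 1 1" for x y \<alpha> \<beta> \<gamma>
    proof -
      obtain k l where kl: "k \<noteq> 1" "x = u k" "l \<noteq> 1" "y = u l" "k \<noteq> l"
        using xy by (auto simp: U_def)
      \<comment> \<open>For \<open>k\<close> and \<open>l\<close> distinct and different from 1,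
        \<open>u l\<close> has coordinate 0 at \<open>k\<close> and 1 at \<open>l\<close>.\<close>
      then have "(\<alpha> *s x + \<beta> *s y) $ k = \<alpha>" "(\<alpha> *s x + \<beta> *s y) $ l = \<beta>"
        by (auto simp: u e_def axis_def)
      with kl show ?thesis unfolding eq by (auto simp: axis_def)
    qed
    have U_nonscalar: "x \<noteq> r *s axis 1 1" if x: "x \<in> U" for x r
    proof
      assume eq: "x = r *s axis 1 1"
      obtain k where k: "k \<noteq> 1" "x = u k"
        using x by (auto simp: U_def)
      then have "x $ k = 1"
        by (simp add: u e_def axis_def)
      moreover have "x $ k = 0"
        unfolding eq using k(1) by (simp add: axis_def)
      ultimately show False by simp
    qed
    have U_span: "vec.span (insert (axis 1 1) U) = UNIV"
    proof -
      have "e k \<in> vec.span (insert (axis 1 1) U)" for k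
      proof (cases "k = 1")
        case True
        then show ?thesis by (simp add: e_def vec.span_base)
      next
        case False
        then have "e k = u k + (c $ k $ k $ k / 2) *s axis 1 1" "u k \<in> U"
          by (simp_all add: u U_def)
        then show ?thesis
          by (metis insertI1 insertI2 vec.span_add vec.span_base vec.span_scale)
      qed
      then have "cart_basis \<subseteq> vec.span (insert (axis 1 1) U)"
        by (auto simp: cart_basis_eq e_def)
      then show ?thesis
        using vec.span_minimal[OF _ vec.subspace_span] span_cart_basis by blast
    qed
    have "(2 :: 4) \<noteq> 1" by simp
    then have U_nonempty: "U \<noteq> {}" unfolding U_def by blast
    have "\<exists>x\<in>U. \<exists>y\<in>insert 0 U. \<exists>a. a \<noteq> 0 \<and> table_mult c (x + y) (x + y) = a *s axis 1 1 \<and>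
        (\<forall>r. x + y \<noteq> r *s axis 1 1)"
      by (rule ex_square_nonzero[OF two U_sq _ U_nonscalar U_span U_nonempty])
        (use U_indep in blast)+
    then obtain x y a where xy: "x \<in> U" "y \<in> insert 0 U" and a: "a \<noteq> 0"
      and "table_mult c (x + y) (x + y) = a *s axis 1 1" "\<forall>r. x + y \<noteq> r *s axis 1 1"
      by (elim bexE exE conjE)
    moreover have "\<exists>s\<in>std_sums. x + y = normalize_gen c s"
    proof -
      \<comment> \<open>Covers the summand \<open>y = 0\<close>. With additivity outside
        characteristic 2, a sum of normalized vectors is again a normalized candidate.\<close>
      have zero: "normalize_gen c 0 = 0"
        by (simp add: normalize_gen_def trace_form_def)
      have U: "\<exists>s\<in>cart_basis. v = normalize_gen c s" if "v \<in> U" for v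
        using that by (auto simp: U_def u_def cart_basis_eq e_def)
      obtain s where "s \<in> cart_basis" "x = normalize_gen c s"
        using U[OF xy(1)] by blast
      moreover obtain s' where "s' \<in> insert 0 cart_basis" "y = normalize_gen c s'"
        using U[of y] xy(2) zero by (metis insert_iff)
      ultimately have "s + s' \<in> std_sums" "x + y = normalize_gen c (s + s')"
        using normalize_gen_add[OF False] by (auto simp only: std_sums_def UN_iff singleton_iff)
      then show ?thesis by blast
    qed
    ultimately obtain s where s: "s \<in> std_sums"
      and sq: "table_mult c (normalize_gen c s) (normalize_gen c s) = a *s axis 1 1"
      and nonscalar: "\<And>r. normalize_gen c s \<noteq> r *s axis 1 1" by metis
    define i where "i = normalize_gen c s"
    \<comment> \<open>Trace 0 and norm \<open>- a\<close>, so the discriminant is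
      \<open>4 a\<close>.\<close>
    have ii: "table_mult c i i = 0 *s i - (- a) *s axis 1 1"
      using sq by (simp add: i_def)
    have "0 * 0 - 4 * (- a) = 2 * (2 * a)" by simp
    then have disc: "0 * 0 - 4 * (- a) \<noteq> 0" using two a by (metis mult_eq_0_iff)
    from comm[OF ii disc nonscalar[folded i_def]] obtain z b where z: "z \<in> std_sums" "b \<noteq> 0"
      and jj: "table_mult c (commutator c i z) (commutator c i z) = b *s axis 1 1" by blast
    have "table_mult c (commutator c i z) i = - table_mult c i (commutator c i z)"
      using commutator_mul[OF ii, of z] by (simp add: commutator_def)
    then have "quat_gens a b i (commutator c i z)"
      using sq[folded i_def] jj z a False by (simp add: quat_gens_def quat_params_def)
    then show ?thesis using s z unfolding i_def by blast
  qed
qed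

section \<open>Computable functions of encoded field elements\<close>

lemma eval_Proj: "i < length xs \<Longrightarrow> xs ! i = y \<Longrightarrow> eval (Proj i) xs y"
  using eval.Proj by blast

lemma eval_Comp1: "eval g xs y \<Longrightarrow> eval f [y] z \<Longrightarrow> eval (Comp f [g]) xs z"
  by (rule eval.Comp[where ys="[y]"]) auto

lemma eval_Comp2: "eval g xs y \<Longrightarrow> eval h xs y' \<Longrightarrow> eval f [y, y'] z \<Longrightarrow> eval (Comp f [g, h]) xs z"
  by (rule eval.Comp[where ys="[y, y']"]) auto

lemma eval_Comp3: "eval g xs y \<Longrightarrow> eval h xs y' \<Longrightarrow> eval k xs y'' \<Longrightarrow> eval f [y, y', y''] z \<Longrightarrow>
    eval (Comp f [g, h, k]) xs z"
  by (rule eval.Comp[where ys="[y, y', y'']"]) auto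

primrec const_recf :: "nat \<Rightarrow> recf" where
  "const_recf 0 = Zero"
| "const_recf (Suc n) = Comp Succ [const_recf n]"

lemma eval_const_recf: "eval (const_recf n) xs n"
  by (induction n) (auto intro: eval.Zero eval_Comp1 eval.Succ)

definition add_recf :: recf where
  "add_recf = PrimRec (Proj 0) (Comp Succ [Proj 1])"

lemma eval_add_recf: "eval add_recf [m, n] (m + n)"
  unfolding add_recf_def
proof (induction m)
  case 0
  show ?case by (simp add: eval.PrimRec_0 eval_Proj)
next
  case (Suc m)
  have "eval (Comp Succ [Proj 1]) [m, m + n, n] (Suc (m + n))"
    by (rule eval_Comp1[OF eval_Proj eval.Succ]) simp_all
  from eval.PrimRec_Suc[OF Suc this] show ?case by simp
qed

definition triangle_recf :: recf where
  "triangle_recf = PrimRec Zero (Comp add_recf [Proj 1, Comp Succ [Proj 0]])"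

lemma eval_triangle_recf: "eval triangle_recf [n] (triangle n)"
  unfolding triangle_recf_def
proof (induction n)
  case 0
  show ?case by (simp add: eval.PrimRec_0 eval.Zero)
next
  case (Suc n)
  have "eval (Comp add_recf [Proj 1, Comp Succ [Proj 0]]) [n, triangle n] (triangle n + Suc n)"
    by (rule eval_Comp2[OF eval_Proj eval_Comp1[OF eval_Proj eval.Succ] eval_add_recf]) simp_all
  from eval.PrimRec_Suc[OF Suc this] show ?case by simp
qed

text \<open>\<open>list_encode (x # xs)\<close> is the successor of the Cantor pair of
  \<open>x\<close> and \<open>list_encode xs\<close>, and the pair of \<open>m\<close> and
  \<open>n\<close> is \<open>triangle (m + n) + m\<close>.\<close>

definition cons_recf :: recf where
  "cons_recf = Comp Succ [Comp add_recf [Comp triangle_recf [add_recf], Proj 0]]"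

lemma eval_cons_recf: "eval cons_recf [x, list_encode xs] (list_encode (x # xs))"
proof -
  have "eval (Comp triangle_recf [add_recf]) [x, list_encode xs] (triangle (x + list_encode xs))"
    by (rule eval_Comp1[OF eval_add_recf eval_triangle_recf])
  then have "eval (Comp add_recf [Comp triangle_recf [add_recf], Proj 0]) [x, list_encode xs]
      (triangle (x + list_encode xs) + x)"
    by (rule eval_Comp2[OF _ eval_Proj eval_add_recf]) simp_all
  from eval_Comp1[OF this eval.Succ] show ?thesis
    by (simp add: cons_recf_def prod_encode_def)
qed

definition list_recf :: "recf list \<Rightarrow> recf" where
  "list_recf ps = foldr (\<lambda>p q. Comp cons_recf [p, q]) ps Zero"

lemma eval_list_recf:
  assumes "list_all2 (\<lambda>p y. eval p xs y) ps ys"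
  shows "eval (list_recf ps) xs (list_encode ys)"
  using assms
  by (induction rule: list_all2_induct)
    (auto simp: list_recf_def simp del: list_encode.simps(2)
      intro: eval.Zero eval_Comp2 eval_cons_recf)

text \<open>Both branches are evaluated before the selection, so both must halt.\<close>

definition select_recf :: recf where
  "select_recf = PrimRec (Proj 0) (Proj 3)"

lemma eval_select_recf: "eval select_recf [of_bool P, x, y] (if P then y else x)"
proof -
  have 0: "eval select_recf [0, x, y] x"
    unfolding select_recf_def by (intro eval.PrimRec_0 eval_Proj) simp_all
  \<comment> \<open>The recursion step receives the counter, the previous value, \<open>x\<close>
    and \<open>y\<close>, so index 3 is \<open>y\<close>.\<close>
  have "eval (Proj 3) [0, x, x, y] y" by (rule eval_Proj) simp_all
  with 0 have "eval select_recf [Suc 0, x, y] y"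
    unfolding select_recf_def by (rule eval.PrimRec_Suc)
  with 0 show ?thesis by simp
qed

section \<open>Closure properties of functions computable from encoded inputs\<close>

locale field_coding =
  fixes dec :: "bool list \<Rightarrow> 'a::field option" and inp :: "'s \<Rightarrow> 'a list"
  assumes computable: "computable_field dec"
begin

definition computes :: "recf \<Rightarrow> ('s \<Rightarrow> 'a) \<Rightarrow> bool" where
  "computes p f \<longleftrightarrow> (\<forall>c ws. encodes dec ws (inp c) \<longrightarrow>
    (\<exists>w. eval p (map code ws) (code w) \<and> dec w = Some (f c)))"

definition comp :: "('s \<Rightarrow> 'a) \<Rightarrow> bool" where
  "comp f \<longleftrightarrow> (\<exists>p. computes p f)"

text \<open>Truth values are the field elements 0 and 1, so negation and conjunction become field
  arithmetic and a test is just another computable function.\<close>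

definition decidable :: "('s \<Rightarrow> bool) \<Rightarrow> bool" where
  "decidable P \<longleftrightarrow> comp (\<lambda>c. of_bool (P c))"

lemma comp_input:
  assumes "\<And>c. n < length (inp c)" "\<And>c. inp c ! n = f c"
  shows "comp f"
proof -
  have "\<exists>w. eval (Proj n) (map code ws) (code w) \<and> dec w = Some (f c)"
    if "encodes dec ws (inp c)" for c ws
  proof -
    have eq: "map dec ws = map Some (inp c)" using that by (simp add: encodes_def)
    then have "length ws = length (inp c)" by (metis length_map)
    then have "n < length ws" "dec (ws ! n) = Some (f c)"
      using eq assms by (metis, metis nth_map)
    then show ?thesis by (auto intro!: eval_Proj)
  qed
  then show ?thesis unfolding comp_def computes_def by blast
qed

lemma comp_const: "comp (\<lambda>c. x)"
proof -
  obtain w where "dec w = Some x" using computable unfolding computable_field_def by blast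
  then show ?thesis
    unfolding comp_def computes_def by (metis eval_const_recf)
qed

lemma comp_binop:
  assumes p: "computes_binop dec p D h" and "comp f" "comp g" and D: "\<And>c. D (f c) (g c)"
  shows "comp (\<lambda>c. h (f c) (g c))"
proof -
  obtain q r where q: "computes q f" and r: "computes r g"
    using assms by (auto simp: comp_def)
  have "computes (Comp p [q, r]) (\<lambda>c. h (f c) (g c))"
    unfolding computes_def
  proof (intro allI impI)
    fix c ws assume ws: "encodes dec ws (inp c)"
    obtain u where u: "eval q (map code ws) (code u)" "dec u = Some (f c)"
      using q ws unfolding computes_def by blast
    obtain v where v: "eval r (map code ws) (code v)" "dec v = Some (g c)"
      using r ws unfolding computes_def by blast
    obtain w where "eval p [code u, code v] (code w)" "dec w = Some (h (f c) (g c))"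
      using p u v D unfolding computes_binop_def by blast
    with u v show "\<exists>w. eval (Comp p [q, r]) (map code ws) (code w) \<and> dec w = Some (h (f c) (g c))"
      using eval_Comp2 by blast
  qed
  then show ?thesis unfolding comp_def by blast
qed

lemma comp_add: "comp f \<Longrightarrow> comp g \<Longrightarrow> comp (\<lambda>c. f c + g c)"
  and comp_diff: "comp f \<Longrightarrow> comp g \<Longrightarrow> comp (\<lambda>c. f c - g c)"
  and comp_mult: "comp f \<Longrightarrow> comp g \<Longrightarrow> comp (\<lambda>c. f c * g c)"
  using computable comp_binop[where D="\<lambda>x y. True"] unfolding computable_field_def by blast+

lemma comp_divide_nonzero: "comp f \<Longrightarrow> comp g \<Longrightarrow> (\<And>c. g c \<noteq> 0) \<Longrightarrow> comp (\<lambda>c. f c / g c)"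
  using computable comp_binop[where D="\<lambda>x y. y \<noteq> 0"] unfolding computable_field_def by blast

lemma zero_test:
  assumes "comp f"
  obtains p where "\<And>c ws. encodes dec ws (inp c) \<Longrightarrow> eval p (map code ws) (of_bool (f c = 0))"
proof -
  obtain q where q: "computes q f" using assms by (auto simp: comp_def)
  obtain z where z: "\<And>w x. dec w = Some x \<Longrightarrow> eval z [code w] (if x = 0 then 1 else 0)"
    using computable unfolding computable_field_def by blast
  have "eval (Comp z [q]) (map code ws) (of_bool (f c = 0))" if "encodes dec ws (inp c)" for c ws
  proof -
    obtain w where w: "eval q (map code ws) (code w)" "dec w = Some (f c)"
      using q \<open>encodes dec ws (inp c)\<close> unfolding computes_def by blast
    from eval_Comp1[OF w(1) z[OF w(2)]] show ?thesis by (simp add: of_bool_def)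
  qed
  then show thesis using that by blast
qed

lemma comp_if_zero:
  assumes "comp f" "comp g" "comp h"
  shows "comp (\<lambda>c. if f c = 0 then g c else h c)"
proof -
  obtain z where z: "\<And>c ws. encodes dec ws (inp c) \<Longrightarrow> eval z (map code ws) (of_bool (f c = 0))"
    using zero_test[OF assms(1)] by blast
  obtain q r where q: "computes q g" and r: "computes r h"
    using assms by (auto simp: comp_def)
  have "computes (Comp select_recf [z, r, q]) (\<lambda>c. if f c = 0 then g c else h c)"
    unfolding computes_def
  proof (intro allI impI)
    fix c ws assume ws: "encodes dec ws (inp c)"
    obtain u where u: "eval q (map code ws) (code u)" "dec u = Some (g c)"
      using q ws unfolding computes_def by blast
    obtain v where v: "eval r (map code ws) (code v)" "dec v = Some (h c)"
      using r ws unfolding computes_def by blast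
    have "eval (Comp select_recf [z, r, q]) (map code ws) (code (if f c = 0 then u else v))"
      using eval_Comp3[OF z[OF ws] v(1) u(1) eval_select_recf] by (simp add: if_distrib)
    with u v show "\<exists>w. eval (Comp select_recf [z, r, q]) (map code ws) (code w) \<and>
        dec w = Some (if f c = 0 then g c else h c)"
      by (intro exI[of _ "if f c = 0 then u else v"]) auto
  qed
  then show ?thesis unfolding comp_def by blast
qed

text \<open>Both branches run, so a zero denominator is replaced by 1 before dividing. The outer
  conditional restores the convention \<open>x / 0 = 0\<close>.\<close>

lemma comp_divide:
  assumes "comp f" "comp g"
  shows "comp (\<lambda>c. f c / g c)"
proof -
  have "comp (\<lambda>c. if g c = 0 then 0 else f c / (if g c = 0 then 1 else g c))"
    by (intro comp_if_zero comp_divide_nonzero comp_const assms) simp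
  moreover have "(\<lambda>c. if g c = 0 then 0 else f c / (if g c = 0 then 1 else g c)) = (\<lambda>c. f c / g c)"
    by auto
  ultimately show ?thesis by simp
qed

lemma comp_sum: "finite A \<Longrightarrow> (\<And>x. x \<in> A \<Longrightarrow> comp (f x)) \<Longrightarrow> comp (\<lambda>c. \<Sum>x\<in>A. f x c)"
  by (induction A rule: finite_induct) (auto intro: comp_const comp_add)

lemma comp_prod: "finite A \<Longrightarrow> (\<And>x. x \<in> A \<Longrightarrow> comp (f x)) \<Longrightarrow> comp (\<lambda>c. \<Prod>x\<in>A. f x c)"
  by (induction A rule: finite_induct) (auto intro: comp_const comp_mult)

text \<open>The Leibniz formula is a sum over finitely many permutations with constant
  signs.\<close>

lemma comp_det:
  fixes A :: "'s \<Rightarrow> 'a^'n^'n"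
  shows "(\<And>r k. comp (\<lambda>c. A c $ r $ k)) \<Longrightarrow> comp (\<lambda>c. det (A c))"
  unfolding det_def by (intro comp_sum comp_mult comp_const comp_prod) (auto simp: finite_permutations)

lemma decidable_eq:
  assumes "comp f" "comp g"
  shows "decidable (\<lambda>c. f c = g c)"
proof -
  have "comp (\<lambda>c. if f c - g c = 0 then 1 else 0)"
    by (intro comp_if_zero comp_diff comp_const assms)
  then show ?thesis by (simp add: decidable_def of_bool_def)
qed

lemma comp_if:
  assumes "decidable P" "comp f" "comp g"
  shows "comp (\<lambda>c. if P c then f c else g c)"
proof -
  have "comp (\<lambda>c. if of_bool (P c) = (0 :: 'a) then g c else f c)"
    using assms unfolding decidable_def by (intro comp_if_zero)
  moreover have "(\<lambda>c. if of_bool (P c) = (0 :: 'a) then g c else f c) = (\<lambda>c. if P c then f c else g c)"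
    by auto
  ultimately show ?thesis by simp
qed

lemma decidable_not: "decidable P \<Longrightarrow> decidable (\<lambda>c. \<not> P c)"
  unfolding decidable_def of_bool_not_iff by (intro comp_diff comp_const)

lemma decidable_conj: "decidable P \<Longrightarrow> decidable Q \<Longrightarrow> decidable (\<lambda>c. P c \<and> Q c)"
  unfolding decidable_def of_bool_conj by (rule comp_mult)

text \<open>Lets conditions on the field alone, such as \<open>CHAR('a) = 2\<close>, be built into
  the program.\<close>

lemma decidable_const: "decidable (\<lambda>c. P)"
  unfolding decidable_def by (rule comp_const)

lemma decidable_ball: "finite A \<Longrightarrow> (\<And>x. x \<in> A \<Longrightarrow> decidable (P x)) \<Longrightarrow> decidable (\<lambda>c. \<forall>x\<in>A. P x c)"
  by (induction A rule: finite_induct) (auto intro: decidable_const decidable_conj)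

definition comp_vec :: "('s \<Rightarrow> 'a^'n) \<Rightarrow> bool" where
  "comp_vec v \<longleftrightarrow> (\<forall>k. comp (\<lambda>c. v c $ k))"

lemma comp_vecI: "(\<And>k. comp (\<lambda>c. v c $ k)) \<Longrightarrow> comp_vec v"
  and comp_vecD: "comp_vec v \<Longrightarrow> comp (\<lambda>c. v c $ k)"
  by (simp_all add: comp_vec_def)

lemma comp_vec_const: "comp_vec (\<lambda>c. v)"
  by (intro comp_vecI comp_const)

lemma comp_vec_add: "comp_vec v \<Longrightarrow> comp_vec w \<Longrightarrow> comp_vec (\<lambda>c. v c + w c)"
  and comp_vec_diff: "comp_vec v \<Longrightarrow> comp_vec w \<Longrightarrow> comp_vec (\<lambda>c. v c - w c)"
  and comp_vec_scale: "comp f \<Longrightarrow> comp_vec v \<Longrightarrow> comp_vec (\<lambda>c. f c *s v c)"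
  by (simp_all add: comp_vec_def comp_add comp_diff comp_mult)

lemma decidable_vec_eq: "comp_vec v \<Longrightarrow> comp_vec w \<Longrightarrow> decidable (\<lambda>c. v c = w c)"
  using decidable_ball[of UNIV "\<lambda>k c. v c $ k = w c $ k"]
  by (simp add: vec_eq_iff decidable_eq comp_vecD)

lemma comp_vec_if: "decidable P \<Longrightarrow> comp_vec v \<Longrightarrow> comp_vec w \<Longrightarrow> comp_vec (\<lambda>c. if P c then v c else w c)"
  by (auto intro!: comp_vecI comp_if simp: comp_vecD if_distrib[of "\<lambda>x. x $ _"])

text \<open>Finite search as a nest of conditionals. It always returns some pair, so the caller must
  test the result once more.\<close>

lemma comp_vec_pair_choice:
  fixes v :: "'i \<Rightarrow> 's \<Rightarrow> 'a^'n" and w :: "'i \<Rightarrow> 's \<Rightarrow> 'a^'m"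
  assumes "finite A" and vw: "\<And>x. x \<in> A \<Longrightarrow> comp_vec (v x)" "\<And>x. x \<in> A \<Longrightarrow> comp_vec (w x)"
    and P: "\<And>f g. comp_vec f \<Longrightarrow> comp_vec g \<Longrightarrow> decidable (\<lambda>c. P c (f c) (g c))"
  shows "\<exists>f g. comp_vec f \<and> comp_vec g \<and> (\<forall>c. (\<exists>x\<in>A. P c (v x c) (w x c)) \<longrightarrow> P c (f c) (g c))"
  using assms(1) vw
proof (induction A rule: finite_induct)
  case empty
  show ?case by (intro exI[of _ "\<lambda>c. 0"] conjI comp_vec_const) simp
next
  case (insert x A)
  then obtain f g where fg: "comp_vec f" "comp_vec g"
    and *: "\<And>c. \<exists>x\<in>A. P c (v x c) (w x c) \<Longrightarrow> P c (f c) (g c)" by auto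
  have vw: "comp_vec (v x)" "comp_vec (w x)" using insert.prems by auto
  note dec = P[OF vw]
  show ?case
  proof (intro exI conjI allI impI)
    show "comp_vec (\<lambda>c. if P c (v x c) (w x c) then v x c else f c)"
      by (rule comp_vec_if[OF dec vw(1) fg(1)])
    show "comp_vec (\<lambda>c. if P c (v x c) (w x c) then w x c else g c)"
      by (rule comp_vec_if[OF dec vw(2) fg(2)])
    fix c assume "\<exists>y\<in>insert x A. P c (v y c) (w y c)"
    then show "P c (if P c (v x c) (w x c) then v x c else f c)
        (if P c (v x c) (w x c) then w x c else g c)"
      using *[of c] by (cases "P c (v x c) (w x c)") auto
  qed
qed

lemma comp_outputs:
  assumes "\<And>f. f \<in> set fs \<Longrightarrow> comp f"
  obtains ps where "\<And>c ws. encodes dec ws (inp c) \<Longrightarrow>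
    \<exists>out. list_all2 (\<lambda>p w. eval p (map code ws) (code w)) ps out \<and> encodes dec out (map (\<lambda>f. f c) fs)"
proof -
  have "\<exists>ps. \<forall>c ws. encodes dec ws (inp c) \<longrightarrow>
    (\<exists>out. list_all2 (\<lambda>p w. eval p (map code ws) (code w)) ps out \<and> encodes dec out (map (\<lambda>f. f c) fs))"
    using assms
  proof (induction fs)
    case Nil
    then show ?case by (intro exI[of _ "[]"]) (auto simp: encodes_def)
  next
    case (Cons f fs)
    then obtain ps where ps: "\<And>c ws. encodes dec ws (inp c) \<Longrightarrow>
      \<exists>out. list_all2 (\<lambda>p w. eval p (map code ws) (code w)) ps out \<and> encodes dec out (map (\<lambda>f. f c) fs)"
      by auto
    obtain p where p: "computes p f" using Cons.prems by (auto simp: comp_def)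
    show ?case
    proof (intro exI[of _ "p # ps"] allI impI)
      fix c ws assume ws: "encodes dec ws (inp c)"
      obtain out where "list_all2 (\<lambda>p w. eval p (map code ws) (code w)) ps out"
        "encodes dec out (map (\<lambda>f. f c) fs)" using ps[OF ws] by blast
      moreover obtain w where "eval p (map code ws) (code w)" "dec w = Some (f c)"
        using p ws unfolding computes_def by blast
      ultimately show "\<exists>out. list_all2 (\<lambda>p w. eval p (map code ws) (code w)) (p # ps) out \<and>
          encodes dec out (map (\<lambda>f. f c) (f # fs))"
        by (intro exI[of _ "w # out"]) (simp add: encodes_def)
    qed
  qed
  then show thesis using that by blast
qed

text \<open>The outputs are computed even when \<open>P\<close> fails and are then discarded by the
  selection.\<close>

lemma decision_program:
  assumes "decidable P" "\<And>f. f \<in> set fs \<Longrightarrow> comp f"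
  obtains p where "\<And>c ws. encodes dec ws (inp c) \<Longrightarrow> P c \<Longrightarrow>
      \<exists>out. eval p (map code ws) (list_encode (1 # map code out)) \<and> encodes dec out (map (\<lambda>f. f c) fs)"
    and "\<And>c ws. encodes dec ws (inp c) \<Longrightarrow> \<not> P c \<Longrightarrow> eval p (map code ws) (list_encode [0])"
proof -
  obtain ps where ps: "\<And>c ws. encodes dec ws (inp c) \<Longrightarrow>
    \<exists>out. list_all2 (\<lambda>p w. eval p (map code ws) (code w)) ps out \<and> encodes dec out (map (\<lambda>f. f c) fs)"
    using comp_outputs[OF assms(2)] by blast
  obtain z where z: "\<And>c ws. encodes dec ws (inp c) \<Longrightarrow>
      eval z (map code ws) (of_bool (of_bool (P c) = (0 :: 'a)))"
    using zero_test[OF assms(1)[unfolded decidable_def]] by blast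
  \<comment> \<open>\<open>z\<close> tests whether the truth value is 0, that is, whether
    \<open>P\<close> fails, so the rejecting output stands in the last position.\<close>
  define p where "p = Comp select_recf [z, list_recf (const_recf 1 # ps), list_recf [const_recf 0]]"
  have "\<exists>out. eval p (map code ws) (if P c then list_encode (1 # map code out) else list_encode [0]) \<and>
      encodes dec out (map (\<lambda>f. f c) fs)" if ws: "encodes dec ws (inp c)" for c ws
  proof -
    obtain out where out: "list_all2 (\<lambda>p w. eval p (map code ws) (code w)) ps out"
      "encodes dec out (map (\<lambda>f. f c) fs)" using ps[OF ws] by blast
    have 1: "eval (list_recf (const_recf 1 # ps)) (map code ws) (list_encode (1 # map code out))"
      using out(1) by (intro eval_list_recf) (auto simp: list_all2_map2
          intro: eval_const_recf simp del: const_recf.simps One_nat_def)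
    have 0: "eval (list_recf [const_recf 0]) (map code ws) (list_encode [0])"
      by (intro eval_list_recf) (auto intro: eval_const_recf simp del: const_recf.simps)
    show ?thesis
      using eval_Comp3[OF z[OF ws] 1 0 eval_select_recf] out(2) unfolding p_def
      by (intro exI[of _ out]) (simp split: if_splits del: list_encode.simps One_nat_def)
  qed
  note result = this
  show thesis
  proof (rule that)
    fix c ws assume ws: "encodes dec ws (inp c)"
    {
      assume "P c"
      then show "\<exists>out. eval p (map code ws) (list_encode (1 # map code out)) \<and>
          encodes dec out (map (\<lambda>f. f c) fs)"
        using result[OF ws] by (simp only: if_True)
    next
      assume "\<not> P c"
      then show "eval p (map code ws) (list_encode [0])"
        using result[OF ws] by (simp only: if_False) blast
    }
  qed
qed

end

section \<open>The decision procedure\<close>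

text \<open>The position comes from the list of index triples and is the same for all tables, so one
  projection reads the entry.\<close>

lemma table_entries_nth:
  "\<exists>n. \<forall>c :: 'a^4^4^4. n < length (table_entries c) \<and> table_entries c ! n = c $ i $ j $ k"
proof -
  define X where "X = [1, 2, 3, 4 :: 4]"
  define L where "L = [(i, j, k). i \<leftarrow> X, j \<leftarrow> X, k \<leftarrow> X]"
  have "l \<in> set X" for l
    using exhaust_4[of l] by (auto simp: X_def)
  then have "(i, j, k) \<in> set L"
    by (auto simp: L_def)
  then obtain n where n: "n < length L" "L ! n = (i, j, k)"
    by (auto simp: in_set_conv_nth)
  have "table_entries c = map (\<lambda>(i, j, k). c $ i $ j $ k) L" for c :: "'a^4^4^4"
    by (simp add: table_entries_def L_def X_def)
  with n have "n < length (table_entries c) \<and> table_entries c ! n = c $ i $ j $ k" for c :: "'a^4^4^4"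
    by simp
  then show ?thesis by blast
qed

lemma comp_table_entry:
  fixes dec :: "bool list \<Rightarrow> 'a::field option"
  assumes "field_coding dec"
  shows "field_coding.comp dec table_entries (\<lambda>c. c $ i $ j $ k)"
proof -
  interpret field_coding dec "table_entries :: 'a^4^4^4 \<Rightarrow> 'a list" by fact
  obtain n where "\<And>c :: 'a^4^4^4. n < length (table_entries c)"
    "\<And>c :: 'a^4^4^4. table_entries c ! n = c $ i $ j $ k"
    using table_entries_nth[of i j k] by blast
  then show ?thesis by (rule comp_input)
qed

lemma comp_vec_table_mult:
  fixes dec :: "bool list \<Rightarrow> 'a::field option"
  assumes "field_coding dec"
  shows "field_coding.comp_vec dec table_entries v \<Longrightarrow> field_coding.comp_vec dec table_entries w \<Longrightarrow>
    field_coding.comp_vec dec table_entries (\<lambda>c. table_mult c (v c) (w c))"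
proof -
  interpret field_coding dec "table_entries :: 'a^4^4^4 \<Rightarrow> 'a list" by fact
  assume vw: "comp_vec v" "comp_vec w"
  show "comp_vec (\<lambda>c. table_mult c (v c) (w c))"
  proof (rule comp_vecI)
    fix k
    have entry: "comp (\<lambda>c. c $ i $ j $ k)" for i j
      by (rule comp_table_entry[OF field_coding_axioms])
    have "comp (\<lambda>c. \<Sum>i\<in>UNIV. \<Sum>j\<in>UNIV. v c $ i * w c $ j * c $ i $ j $ k)"
      by (intro comp_sum comp_mult comp_vecD[OF vw(1)] comp_vecD[OF vw(2)] entry
          finite_class.finite_UNIV)
    then show "comp (\<lambda>c. table_mult c (v c) (w c) $ k)"
      by (simp add: table_mult_def)
  qed
qed

theorem mainTheorem7:
  fixes dec :: "bool list \<Rightarrow> 'a::field option"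
  assumes "computable_field dec"
  shows "\<exists>p :: recf. \<forall>(c :: 'a^4^4^4) ws.
    multiplication_table c \<and> encodes dec ws (table_entries c) \<longrightarrow>
    (if quaternion_algebra (*s) (table_mult c) (axis 1 1)
     then \<exists>(a :: 'a) (b :: 'a) (M :: 'a^4^4) out.
       eval p (map code ws) (list_encode (1 # map code out)) \<and>
       encodes dec out (a # b # matrix_entries M) \<and>
       quat_params a b \<and>
       algebra_iso (*s) (table_mult c) (axis 1 1)
         (*s) (table_mult (quat_table a b)) (axis 1 1) ((*v) M)
     else eval p (map code ws) (list_encode [0]))"
proof -
  interpret field_coding dec "table_entries :: 'a^4^4^4 \<Rightarrow> 'a list"
    by (rule field_coding.intro) fact
  note mult = comp_vec_table_mult[OF field_coding_axioms]
  let ?one = "axis 1 1 :: 'a^4"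
  \<comment> \<open>If the relations hold for some \<open>a\<close> and \<open>b\<close>, these are
    the first coordinates of \<open>i i\<close> (plus \<open>i\<close> in characteristic 2) and of
    \<open>j j\<close>. Computing them replaces the existential quantifier over the field by a
    decidable test.\<close>
  define par_a where "par_a c i = (if CHAR('a) = 2 then table_mult c i i + i else table_mult c i i) $ 1"
    for c :: "'a^4^4^4" and i
  define par_b where "par_b c j = table_mult c j j $ 1" for c :: "'a^4^4^4" and j
  define good where "good c i j \<longleftrightarrow> quat_params (par_a c i) (par_b c j) \<and>
    table_mult c j j = par_b c j *s ?one \<and>
    (if CHAR('a) = 2 then table_mult c i i + i = par_a c i *s ?one \<and>
       table_mult c j i = table_mult c (i + ?one) j
     else table_mult c i i = par_a c i *s ?one \<and> table_mult c j i = - table_mult c i j)"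
    for c i j
  have good_iff: "good c i j \<longleftrightarrow> (\<exists>a b. assoc_algebra.quat_gens (*s) (table_mult c) ?one a b i j)"
    and good_gens: "good c i j \<Longrightarrow>
      assoc_algebra.quat_gens (*s) (table_mult c) ?one (par_a c i) (par_b c j) i j"
    if "multiplication_table c" for c i j
  proof -
    interpret assoc_algebra "(*s)" "table_mult c" ?one
      using that unfolding multiplication_table_def .
    have "a = par_a c i \<and> b = par_b c j" if "quat_gens a b i j" for a b
      using that by (auto simp: quat_gens_def par_a_def par_b_def split: if_splits)
    moreover have "good c i j \<longleftrightarrow> quat_gens (par_a c i) (par_b c j) i j"
      by (simp add: good_def quat_gens_def)
    ultimately show "good c i j \<longleftrightarrow> (\<exists>a b. quat_gens a b i j)"
      "good c i j \<Longrightarrow> quat_gens (par_a c i) (par_b c j) i j" by blast+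
  qed
  have comp_a: "comp (\<lambda>c. par_a c (f c))" if "comp_vec f" for f
    unfolding par_a_def by (intro comp_vecD comp_vec_if decidable_const comp_vec_add mult that)
  have comp_b: "comp (\<lambda>c. par_b c (f c))" if "comp_vec f" for f
    unfolding par_b_def by (intro comp_vecD mult that)
  have dec_good: "decidable (\<lambda>c. good c (f c) (g c))" if fg: "comp_vec f" "comp_vec g" for f g
  proof -
    have "decidable (\<lambda>c. \<not> par_b c (g c) = 0)"
      by (intro decidable_not decidable_eq comp_const comp_b fg)
    moreover have "decidable (\<lambda>c. \<not> par_a c (f c) = 0)"
      by (intro decidable_not decidable_eq comp_const comp_a fg)
    moreover have "comp_vec (\<lambda>c. - table_mult c (f c) (g c))"
      using comp_vec_diff[OF comp_vec_const[of 0] mult[OF fg]] by simp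
    ultimately show ?thesis
      unfolding good_def quat_params_def
      by (cases "CHAR('a) = 2")
        (simp_all, (intro decidable_conj decidable_vec_eq comp_vec_scale comp_vec_add mult fg
          comp_vec_const comp_a comp_b | assumption)+)
  qed
  have comp_normalize: "comp_vec (\<lambda>c. normalize_gen c x)" for x
  proof -
    have "comp (\<lambda>c :: 'a^4^4^4. c $ k $ k $ k)" for k
      by (rule comp_table_entry[OF field_coding_axioms])
    then have "comp (\<lambda>c. trace_form c x)"
      unfolding trace_form_def
      by (intro comp_sum comp_mult comp_const comp_if decidable_const finite_class.finite_UNIV)
    then show ?thesis
      unfolding normalize_gen_def
      by (intro comp_vec_if decidable_const comp_vec_scale comp_vec_diff comp_divide comp_const
          comp_vec_const)
  qed
  \<comment> \<open>The finite search over candidate pairs, giving generators as computable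
    functions of the table.\<close>
  have "\<exists>f g. comp_vec f \<and> comp_vec g \<and> (\<forall>c. (\<exists>x\<in>std_sums \<times> std_sums.
      good c (normalize_gen c (fst x)) (commutator c (normalize_gen c (fst x)) (snd x))) \<longrightarrow>
      good c (f c) (g c))"
    unfolding commutator_def
    by (rule comp_vec_pair_choice)
      (auto intro: finite_std_sums comp_normalize dec_good intro!: comp_vec_diff mult comp_vec_const)
  then obtain f g where fg: "comp_vec f" "comp_vec g"
    and choice: "\<And>c x y. x \<in> std_sums \<Longrightarrow> y \<in> std_sums \<Longrightarrow>
      good c (normalize_gen c x) (commutator c (normalize_gen c x) y) \<Longrightarrow> good c (f c) (g c)"
    by fastforce
  define M where "M c = cramer_inverse (quat_matrix c (f c) (g c))" for c
  have comp_M: "comp (\<lambda>c. M c $ k $ l)" for k l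
  proof -
    have N: "comp (\<lambda>c. quat_matrix c (f c) (g c) $ r $ s)" for r s
      unfolding quat_matrix_def
      by simp (intro comp_if decidable_const comp_const comp_vecD fg mult)
    show ?thesis
      unfolding M_def cramer_inverse_def
      by simp (intro comp_divide comp_det N; simp; intro comp_if decidable_const comp_const N)
  qed
  define fs where "fs = (\<lambda>c. par_a c (f c)) # (\<lambda>c. par_b c (g c)) #
    [\<lambda>c. M c $ i $ j. i \<leftarrow> [1, 2, 3, 4], j \<leftarrow> [1, 2, 3, 4]]"
  have fs: "map (\<lambda>f. f c) fs = par_a c (f c) # par_b c (g c) # matrix_entries (M c)" for c
    by (simp add: fs_def matrix_entries_def)
  have "comp h" if "h \<in> set fs" for h
    using that comp_a[OF fg(1)] comp_b[OF fg(2)] comp_M by (auto simp: fs_def)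
  from decision_program[OF dec_good[OF fg] this]
  obtain p where prog: "\<And>c ws. encodes dec ws (table_entries c) \<Longrightarrow> good c (f c) (g c) \<Longrightarrow>
      \<exists>out. eval p (map code ws) (list_encode (1 # map code out)) \<and>
        encodes dec out (map (\<lambda>f. f c) fs)"
    and no: "\<And>c ws. encodes dec ws (table_entries c) \<Longrightarrow> \<not> good c (f c) (g c) \<Longrightarrow>
      eval p (map code ws) (list_encode [0])"
    by blast
  note yes = prog[unfolded fs]
  \<comment> \<open>A quaternion algebra has good candidates, so the search result is good.
    Conversely, good generators make any table a quaternion algebra.\<close>
  have quat: "quaternion_algebra (*s) (table_mult c) ?one \<longleftrightarrow> good c (f c) (g c)"
    if c: "multiplication_table c" for c
    using quaternion_algebra_imp_quat_gens[of c] quat_gens_imp_quaternion_algebra[OF c]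
      good_iff[OF c] choice by metis
  show ?thesis
  proof (intro exI[of _ p] allI impI)
    fix c :: "'a^4^4^4" and ws
    assume "multiplication_table c \<and> encodes dec ws (table_entries c)"
    then have c: "multiplication_table c" and ws: "encodes dec ws (table_entries c)" by auto
    show "if quaternion_algebra (*s) (table_mult c) ?one
     then \<exists>(a :: 'a) (b :: 'a) (M :: 'a^4^4) out.
       eval p (map code ws) (list_encode (1 # map code out)) \<and>
       encodes dec out (a # b # matrix_entries M) \<and>
       quat_params a b \<and>
       algebra_iso (*s) (table_mult c) ?one
         (*s) (table_mult (quat_table a b)) ?one ((*v) M)
     else eval p (map code ws) (list_encode [0])"
    proof (cases "good c (f c) (g c)")
      case True
      obtain out where "eval p (map code ws) (list_encode (1 # map code out))"
        "encodes dec out (par_a c (f c) # par_b c (g c) # matrix_entries (M c))"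
        using yes[OF ws True] by blast
      moreover have "quat_params (par_a c (f c)) (par_b c (g c))"
        using True by (simp add: good_def)
      moreover have "algebra_iso (*s) (table_mult c) ?one (*s)
          (table_mult (quat_table (par_a c (f c)) (par_b c (g c)))) ?one ((*v) (M c))"
        unfolding M_def by (rule quat_gens_imp_iso[OF c good_gens[OF c True]])
      ultimately show ?thesis using True quat[OF c] by (simp only: if_True) blast
    next
      case False
      then show ?thesis using no[OF ws] quat[OF c] by (simp only: if_False) blast
    qed
  qed
qed

end
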